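(* Let $K$ be an algebraically closed field of characteristic $p>0$, let $d\ge 1$ be an integer, and consider the monomial Artinian complete intersection $A:=K[X,Y,Z]/(X^d,Y^d,Z^d)$. Then the following holds: (1) If $d$ is even, then $A$ does not have the weak Lefschetz property if and only if there exist $k\in\mathbb{N}$ and $n\in\mathbb{N}_+$ such that $$\frac{3d}{6k+2} > p^n > \frac{3d}{6k+4}.$$ (2) If $d$ is odd, then $A$ does not have the weak Lefschetz property if and only if there exist $k\in\mathbb{N}$ and $n\in\mathbb{N}_+$ such that $$\frac{3d-1}{6k+2} > p^n > \frac{3d+1}{6k+4}.$$
   Context: $\mathbb{N}=\{0,1,2,\ldots\}$ and $\mathbb{N}_+=\{1,2,\ldots\}$. Weak Lefschetz property: let $R=K[X,Y,Z]$ with the standard grading, $K$ an algebraically closed field, and let $A=R/I$ be a graded Artinian quotient, $A=K\oplus A_1\oplus\cdots\oplus A_s$ with $A_m$ the degree-$m$ component and $A_m=0$ for $m>s$. $A$ has the weak Lefschetz property if for a general linear form $\ell\in R_1$ (i.e. for all $\ell$ in some nonempty Zariski-open subset of $R_1$) the multiplication maps $A_m\to A_{m+1}$, $a\mapsto \ell a$, have maximal rank (are injective or surjective) for all $m=0,\ldots,s-1$. *)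

theory Defs
  imports
    "HOL-Library.Poly_Mapping"
    "HOL-Library.Numeral_Type"
    "HOL-Computational_Algebra.Polynomial"
    "HOL-Algebra.QuotRing"
    "HOL-Algebra.Algebraic_Closure_Type"
begin

text \<open>
  Polynomials with variables indexed by \<open>'v\<close> and coefficients in \<open>'k\<close>: a monomial is its
  exponent vector, a polynomial is a finitely supported map from monomials to coefficients, and
  the ring structure is the convolution product of \<^theory>\<open>HOL-Library.Poly_Mapping\<close>.
  \<open>K[X,Y,Z]\<close> is obtained with the three-element index type \<open>3\<close>.
\<close>

type_synonym ('v, 'k) mpoly = "('v \<Rightarrow>\<^sub>0 nat) \<Rightarrow>\<^sub>0 'k"

definition mvar :: "'v \<Rightarrow> ('v, 'k::comm_ring_1) mpoly" where
  "mvar i = Poly_Mapping.single (Poly_Mapping.single i 1) 1"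

definition mconst :: "'k::comm_ring_1 \<Rightarrow> ('v, 'k) mpoly" where
  "mconst a = Poly_Mapping.single 0 a"

definition mon_degree :: "('v::finite \<Rightarrow>\<^sub>0 nat) \<Rightarrow> nat" where
  "mon_degree t = (\<Sum>i\<in>UNIV. Poly_Mapping.lookup t i)"

definition homogeneous_part :: "nat \<Rightarrow> ('v::finite, 'k::comm_ring_1) mpoly set" where
  "homogeneous_part m = {f. \<forall>t\<in>Poly_Mapping.keys f. mon_degree t = m}"

definition mpoly_eval :: "('v::finite, 'k::comm_ring_1) mpoly \<Rightarrow> ('v \<Rightarrow> 'k) \<Rightarrow> 'k" where
  "mpoly_eval f x = (\<Sum>t\<in>Poly_Mapping.keys f.
     Poly_Mapping.lookup f t * (\<Prod>i\<in>UNIV. x i ^ Poly_Mapping.lookup t i))"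

text \<open>
  The Zariski topology on the affine space \<open>K\<^sup>n\<close>, with points given as functions \<open>'v \<Rightarrow> 'k\<close>.
  The space of linear forms is identified with it through \<open>linear_form\<close>.
\<close>

definition zariski_closed :: "('v::finite \<Rightarrow> 'k::field) set \<Rightarrow> bool" where
  "zariski_closed V \<longleftrightarrow> (\<exists>S :: ('v, 'k) mpoly set. V = {x. \<forall>f\<in>S. mpoly_eval f x = 0})"

definition zariski_open :: "('v::finite \<Rightarrow> 'k::field) set \<Rightarrow> bool" where
  "zariski_open U \<longleftrightarrow> zariski_closed (- U)"

definition linear_form :: "('v::finite \<Rightarrow> 'k::field) \<Rightarrow> ('v, 'k) mpoly" where
  "linear_form c = (\<Sum>i\<in>UNIV. mconst (c i) * mvar i)"

abbreviation mpoly_ring :: "('v, 'k::comm_ring_1) mpoly ring" where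
  "mpoly_ring \<equiv> ring_of_type_algebra"

text \<open>For a homogeneous ideal \<open>I\<close> of \<open>R\<close>, the image of \<open>R\<^sub>m\<close> in \<open>R/I\<close> is the component \<open>(R/I)\<^sub>m\<close>.\<close>

definition quot_component ::
    "('v::finite, 'k::comm_ring_1) mpoly set \<Rightarrow> nat \<Rightarrow> ('v, 'k) mpoly set set" where
  "quot_component I m = (\<lambda>f. I +>\<^bsub>mpoly_ring\<^esub> f) ` homogeneous_part m"

definition maximal_rank_mult ::
    "('v::finite, 'k::field) mpoly set \<Rightarrow> ('v, 'k) mpoly \<Rightarrow> nat \<Rightarrow> bool" where
  "maximal_rank_mult I l m \<longleftrightarrow>
     (let \<mu> = (\<lambda>a. (I +>\<^bsub>mpoly_ring\<^esub> l) \<otimes>\<^bsub>mpoly_ring Quot I\<^esub> a)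
      in inj_on \<mu> (quot_component I m) \<or>
         \<mu> ` quot_component I m = quot_component I (Suc m))"

text \<open>
  Meant for homogeneous \<open>I\<close> with \<open>R/I\<close> Artinian, so that some \<open>s\<close> bounds the degrees of the
  nonzero components. The choice of \<open>s\<close> does not matter: multiplication into a zero component is
  surjective.
\<close>

definition weak_lefschetz :: "('v::finite, 'k::field) mpoly set \<Rightarrow> bool" where
  "weak_lefschetz I \<longleftrightarrow>
     (\<exists>s. (\<forall>m>s. quot_component I m = {\<zero>\<^bsub>mpoly_ring Quot I\<^esub>}) \<and>
          (\<exists>U. zariski_open U \<and> U \<noteq> {} \<and>
               (\<forall>c\<in>U. \<forall>m<s. maximal_rank_mult I (linear_form c) m)))"

definition monomial_ci_ideal :: "nat \<Rightarrow> (3, 'k::field) mpoly set" where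
  "monomial_ci_ideal d = Idl\<^bsub>mpoly_ring\<^esub> {mvar 1 ^ d, mvar 2 ^ d, mvar 3 ^ d}"

end

theory Submission
  imports Defs "Jordan_Normal_Form.Determinant"
begin

text \<open>
  Put \<open>h = d div 2\<close> and let \<open>l = aX + bY + cZ\<close> with \<open>abc \<noteq> 0\<close>. Every nonempty Zariski-open set of
  linear forms contains such an \<open>l\<close>, and all of them will turn out to behave alike. The ring \<open>A/lA\<close>
  is a quotient of the ring of binary forms, so the ranks of the multiplication maps are a question
  about the relations between \<open>X\<^sup>d\<close>, \<open>Y\<^sup>d\<close> and \<open>(X + Y)\<^sup>d\<close>. Dehomogenized, the
  substitution \<open>X \<mapsto> x/a, Y \<mapsto> 1/b, Z \<mapsto> -(1 + x)/c\<close> maps \<open>K[X,Y,Z]\<close> to \<open>K[x]\<close>, and on forms of a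
  fixed degree its kernel consists of the multiples of \<open>l\<close> (\<open>restrict_line_eq_0D\<close>). A form killed by
  \<open>l\<close> modulo \<open>(X\<^sup>d, Y\<^sup>d, Z\<^sup>d)\<close> becomes a relation \<open>x\<^sup>d A + B + (1 + x)\<^sup>d C = 0\<close> of small degree. In
  the decisive degree this is a nonzero \<open>C\<close> of degree less than \<open>h\<close> such that \<open>(1 + x)\<^sup>d C\<close> has no
  terms in the degrees \<open>h, \<dots>, d - 1\<close>; call it a low syzygy.

  If there is no low syzygy, multiplication by \<open>l\<close> is injective up to degree \<open>d + h - 2\<close>
  (\<open>low_degree_injective\<close>), and the transposed linear system shows that it is surjective in every
  higher degree (\<open>high_degree_surjective\<close>). If there is one, injectivity fails in degree
  \<open>d + h - 2\<close>; the pairing \<open>(P, Q) \<mapsto>\<close> coefficient of \<open>x\<^sup>d\<^sup>-\<^sup>1\<close> in \<open>PQ\<close> shows that surjectivity fails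
  there too. So the weak Lefschetz property means that there is no low syzygy
  (\<open>weak_lefschetz_iff_no_low_syzygy\<close>).

  It remains to decide for which \<open>d\<close> a low syzygy exists. Let \<open>q = p\<^sup>n\<close> with \<open>n \<ge> 1\<close>.
  For an odd exponent \<open>u = 2k + 1\<close> in place of \<open>d\<close>, counting unknowns and equations gives a relation
  whose coefficients have degree at most \<open>k\<close>. Its \<open>q\<close>-th power is a relation for the exponent \<open>uq\<close>,
  and multiplying by powers of \<open>x\<close> and \<open>1 + x\<close> moves it to the exponent \<open>d\<close>. The degree
  stays below \<open>h\<close> exactly if \<open>d\<close> is close enough to \<open>uq\<close>, which is the inequality of the theorem
  (\<open>resonant_imp_low_syzygy\<close>).

  Conversely, low syzygies are the kernel of a Toeplitz matrix of binomial coefficients. Its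
  determinant is MacMahon's product counting plane partitions in a box, a quotient of factorials
  (\<open>det_toeplitz_binomial\<close>). By Legendre's formula its \<open>p\<close>-adic valuation is a sum over
  \<open>q = p, p\<^sup>2, \<dots>\<close>, and for a box with nearly equal sides the summand of \<open>q\<close> vanishes unless the
  sum of the sides lies strictly between \<open>(3k + 1)q\<close> and \<open>(3k + 2)q\<close> for some \<open>k\<close>
  (\<open>box_valuation_eq_0\<close>). For
  \<open>d = 2r\<close> the box is \<open>r \<times> r \<times> r\<close>. For \<open>d = 2r + 1\<close> the linear system is not square, but it
  implies the square systems of the boxes \<open>r \<times> r \<times> (r + 1)\<close> and \<open>r \<times> (r + 1) \<times> (r + 1)\<close>. One of
  them suffices, because \<open>p\<close> cannot divide both \<open>3r + 1\<close> and \<open>3r + 2\<close>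
  (\<open>low_syzygy_imp_resonant\<close>).
\<close>

section \<open>A Toeplitz determinant of binomial coefficients\<close>

definition diag_of :: "nat \<Rightarrow> (nat \<Rightarrow> 'a::comm_ring_1) \<Rightarrow> 'a mat" where
  "diag_of n f = mat n n (\<lambda>(i, j). if i = j then f i else 0)"

lemma diag_of_carrier [simp]: "diag_of n f \<in> carrier_mat n n"
  by (simp add: diag_of_def)

lemma prod_list_diag_mat:
  assumes "A \<in> carrier_mat n n"
  shows "prod_list (diag_mat A) = (\<Prod>i<n. A $$ (i, i))"
  using assms by (auto simp: diag_mat_def prod.list_conv_set_nth atLeast0LessThan)

lemma det_diag_of: "det (diag_of n f) = (\<Prod>i<n. f i)"
proof -
  have "det (diag_of n f) = prod_list (diag_mat (diag_of n f))"
    by (rule det_upper_triangular[of _ n]) (auto simp: diag_of_def)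
  then show ?thesis
    by (simp add: prod_list_diag_mat[of _ n] diag_of_def)
qed

lemma mat_mult_entry:
  "mat n n f * mat n n g = mat n n (\<lambda>(i, j). \<Sum>k<n. f (i, k) * g (k, j))"
  by (rule eq_matI) (auto simp: scalar_prod_def atLeast0LessThan)

lemma det_scale_rows_cols:
  "det (mat n n (\<lambda>(i, j). f i * A i j * g j)) =
     (\<Prod>i<n. f i) * det (mat n n (\<lambda>(i, j). A i j)) * (\<Prod>i<n. g i :: 'a::comm_ring_1)"
proof -
  have "mat n n (\<lambda>(i, j). f i * A i j * g j) =
        diag_of n f * (mat n n (\<lambda>(i, j). A i j)) * diag_of n g"
    by (rule eq_matI)
      (auto simp: diag_of_def mat_mult_entry if_distrib[of "\<lambda>x. x * _"] if_distrib[of "\<lambda>x. _ * x"]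
        cong: if_cong)
  moreover have "diag_of n f * (mat n n (\<lambda>(i, j). A i j)) \<in> carrier_mat n n"
    by (rule mult_carrier_mat[of _ _ n]) auto
  ultimately show ?thesis
    by (simp add: det_mult[of _ n] det_diag_of)
qed

definition pascal_mat :: "nat \<Rightarrow> int mat" where
  "pascal_mat n = mat n n (\<lambda>(i, j). int (j choose i))"

lemma pascal_mat_carrier [simp]: "pascal_mat n \<in> carrier_mat n n"
  by (simp add: pascal_mat_def)

lemma det_pascal_mat: "det (pascal_mat n) = 1"
proof -
  have "det (pascal_mat n) = prod_list (diag_mat (pascal_mat n))"
    by (rule det_upper_triangular[of _ n]) (auto simp: pascal_mat_def)
  then show ?thesis
    by (simp add: prod_list_diag_mat[of _ n] pascal_mat_def)
qed

text \<open>
  The coefficient of \<open>x\<^sup>a\<^sup>+\<^sup>i\<close> in \<open>x\<^sup>j (1 + x)\<^sup>m\<close>: the entries of the matrix of the map that sends a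
  polynomial \<open>C\<close> to a window of coefficients of \<open>(1 + x)\<^sup>m C\<close>.
\<close>

definition toeplitz_binomial :: "nat \<Rightarrow> nat \<Rightarrow> nat \<Rightarrow> nat \<Rightarrow> nat" where
  "toeplitz_binomial m a i j = (if j \<le> a + i then m choose (a + i - j) else 0)"

text \<open>
  Multiplying by the unitriangular Pascal matrix amounts to adding adjacent columns repeatedly. By
  Vandermonde's convolution this turns the Toeplitz matrix into one whose upper argument depends
  on the column and whose lower argument depends on the row; the determinant stays the same.
\<close>

lemma toeplitz_binomial_pascal:
  assumes "j < n"
  shows "(\<Sum>k<n. toeplitz_binomial m a i k * (j choose k)) = (m + j) choose (a + i)"
proof -
  have "(\<Sum>k<n. toeplitz_binomial m a i k * (j choose k)) =
        (\<Sum>k\<in>{..<n} \<inter> {..a + i}. (j choose k) * (m choose (a + i - k)))"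
    by (intro sum.mono_neutral_cong_right) (auto simp: toeplitz_binomial_def)
  also have "\<dots> = (\<Sum>k\<le>a + i. (j choose k) * (m choose (a + i - k)))"
    using assms by (intro sum.mono_neutral_left) (auto simp: not_less binomial_eq_0)
  also have "\<dots> = (j + m) choose (a + i)"
    by (rule vandermonde)
  finally show ?thesis
    by (simp add: add.commute)
qed

text \<open>
  This matrix is the product of a lower unitriangular matrix and the Pascal matrix, again by
  Vandermonde's convolution.
\<close>

lemma det_binomial_shift:
  "det (mat n n (\<lambda>(i, j). int ((b + j) choose i))) = 1"
proof -
  define L where "L = mat n n (\<lambda>(i, k). int (toeplitz_binomial b 0 i k))"
  have "det L = prod_list (diag_mat L)"
    by (rule det_lower_triangular[of n]) (auto simp: L_def toeplitz_binomial_def)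
  then have "det L = 1"
    by (simp add: prod_list_diag_mat[of _ n] L_def toeplitz_binomial_def)
  moreover have "L * pascal_mat n = mat n n (\<lambda>(i, j). int ((b + j) choose i))"
    unfolding L_def pascal_mat_def mat_mult_entry
    by (rule eq_matI) (simp_all flip: of_nat_mult of_nat_sum add: toeplitz_binomial_pascal)
  ultimately show ?thesis
    using det_mult[of L n "pascal_mat n"] by (simp add: det_pascal_mat L_def)
qed

text \<open>
  After the column operations the entry is \<open>(a + b + j choose a + i)\<close>. Up to factors that depend
  on the row or the column only it equals \<open>(b + j choose i)\<close>, a matrix of determinant 1.
  The resulting quotient of factorials is MacMahon's number of plane partitions in an
  \<open>n \<times> a \<times> b\<close> box.
\<close>

lemma det_toeplitz_binomial:
  "(\<Prod>i<n. fact (a + i) * fact (b + i)) *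
     det (mat n n (\<lambda>(i, j). int (toeplitz_binomial (a + b) a i j))) =
   (\<Prod>i<n. fact (a + b + i) * fact i :: int)"
proof -
  define M where "M = mat n n (\<lambda>(i, j). int (toeplitz_binomial (a + b) a i j))"
  define B where "B = (\<lambda>i j. int ((a + b + j) choose (a + i)))"
  have "M * pascal_mat n = mat n n (\<lambda>(i, j). B i j)"
    unfolding M_def pascal_mat_def mat_mult_entry B_def
    by (rule eq_matI) (simp_all flip: of_nat_mult of_nat_sum add: toeplitz_binomial_pascal)
  then have *: "det M = det (mat n n (\<lambda>(i, j). B i j))"
    using det_mult[of M n "pascal_mat n"] by (simp add: det_pascal_mat M_def)
  have entry: "fact (a + i) * B i j * fact (b + j) = fact i * int ((b + j) choose i) * fact (a + b + j)"
    for i j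
  proof (cases "i \<le> b + j")
    case True
    have e1: "fact (a + i) * fact (b + j - i) * ((a + b + j) choose (a + i)) = (fact (a + b + j) :: nat)"
      using binomial_fact_lemma[of "a + i" "a + b + j"] True by (simp add: algebra_simps)
    have e2: "fact i * fact (b + j - i) * ((b + j) choose i) = (fact (b + j) :: nat)"
      using binomial_fact_lemma[of i "b + j"] True by simp
    have "fact (a + i) * ((a + b + j) choose (a + i)) * fact (b + j) =
        (fact i * ((b + j) choose i) * fact (a + b + j) :: nat)"
      by (simp only: e1[symmetric] e2[symmetric] mult_ac)
    then have "int (fact (a + i) * ((a + b + j) choose (a + i)) * fact (b + j)) =
        int (fact i * ((b + j) choose i) * fact (a + b + j))"
      by simp
    then show ?thesis
      by (simp add: B_def)
  qed (simp add: B_def binomial_eq_0)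
  have "mat n n (\<lambda>(i, j). fact (a + i) * B i j * fact (b + j)) =
      mat n n (\<lambda>(i, j). fact i * int ((b + j) choose i) * fact (a + b + j))"
    by (rule cong_mat) (simp_all add: entry)
  from arg_cong[OF this, of det] show ?thesis
    unfolding det_scale_rows_cols det_binomial_shift M_def[symmetric] *
    by (simp add: prod.distrib algebra_simps)
qed

section \<open>The p-adic valuation of the determinant\<close>

lemma multiplicity_eq_sum:
  fixes p m K :: nat
  assumes "prime p" "0 < m" "m \<le> K"
  shows "multiplicity p m = (\<Sum>n\<in>{1..K}. if p ^ n dvd m then 1 else 0)"
proof -
  have "multiplicity p m < p ^ multiplicity p m"
    using assms(1) by (intro power_gt_expt) (simp add: prime_nat_iff)
  also have "p ^ multiplicity p m \<le> m"
    using assms(2) by (intro dvd_imp_le multiplicity_dvd) auto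
  finally have "multiplicity p m \<le> K"
    using assms(3) by simp
  have dvd_iff: "p ^ n dvd m \<longleftrightarrow> n \<le> multiplicity p m" for n
    using assms(1,2) by (intro power_dvd_iff_le_multiplicity) (auto simp: prime_nat_iff)
  have "(\<Sum>n\<in>{1..K}. if p ^ n dvd m then 1 else 0) = (\<Sum>n\<in>{1..multiplicity p m}. 1 :: nat)"
    unfolding dvd_iff using \<open>multiplicity p m \<le> K\<close>
    by (intro sum.mono_neutral_cong_right) auto
  then show ?thesis
    by simp
qed

lemma multiplicity_fact_legendre:
  fixes p n K :: nat
  assumes "prime p" "n \<le> K"
  shows "multiplicity p (fact n) = (\<Sum>e\<in>{1..K}. n div p ^ e)"
  using assms(2)
proof (induction n)
  case (Suc n)
  have "multiplicity p (fact (Suc n) :: nat) = multiplicity p (Suc n) + multiplicity p (fact n :: nat)"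
    using assms(1) by (subst fact_Suc, subst prime_elem_multiplicity_mult_distrib) auto
  also have "\<dots> = (\<Sum>e\<in>{1..K}. (if p ^ e dvd Suc n then 1 else 0) + n div p ^ e)"
    using Suc multiplicity_eq_sum[OF assms(1), of "Suc n" K] by (simp add: sum.distrib)
  also have "\<dots> = (\<Sum>e\<in>{1..K}. Suc n div p ^ e)"
    by (intro sum.cong) (auto simp: div_Suc dvd_eq_mod_eq_0)
  finally show ?case .
qed simp

text \<open>
  Legendre's formula turns each product of consecutive factorials in the determinant into differences of
  values of this function, which is piecewise linear with breaks at the multiples of \<open>q\<close>.
\<close>

definition sum_div :: "nat \<Rightarrow> nat \<Rightarrow> nat" where
  "sum_div q x = (\<Sum>i<x. i div q)"

lemma sum_div_shift: "(\<Sum>i<n. (a + i) div q) = sum_div q (a + n) - sum_div q a"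
proof -
  have "sum_div q (a + n) = sum_div q a + (\<Sum>i<n. (a + i) div q)"
    unfolding sum_div_def by (induction n) auto
  then show ?thesis
    by simp
qed

lemma sum_div_mono: "sum_div q a \<le> sum_div q (a + n)"
  unfolding sum_div_def by (intro sum_mono2) auto

text \<open>
  The formula is also correct at the right end \<open>t = q\<close> of the block, where it agrees with the
  formula of the next one. The twofold value avoids a division.
\<close>

lemma sum_div_eq:
  assumes "t \<le> q" "q > 0"
  shows "2 * int (sum_div q (k * q + t)) = int q * int k * (int k - 1) + 2 * int k * int t"
proof -
  have inner: "sum_div q (k * q + t) = sum_div q (k * q) + k * t" if "t \<le> q" for k t
    using that
  proof (induction t)
    case (Suc t)
    have "(k * q + t) div q = k"
      using Suc assms(2) by simp
    with Suc show ?case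
      by (simp add: sum_div_def)
  qed simp
  have "2 * int (sum_div q (k * q)) = int q * int k * (int k - 1)" for k
  proof (induction k)
    case (Suc k)
    have "sum_div q (Suc k * q) = sum_div q (k * q) + k * q"
      using inner[of q k] by (simp add: add.commute)
    with Suc show ?case
      by (simp add: algebra_simps)
  qed (simp add: sum_div_def)
  then show ?thesis
    using inner[OF assms(1), of k] by (simp add: algebra_simps)
qed

text \<open>
  The linear piece to the left of \<open>kq\<close>, measured downwards from \<open>kq\<close>.
\<close>

lemma sum_div_eq':
  assumes "t \<le> q" "q > 0" "k > 0"
  shows "2 * int (sum_div q (k * q - t)) = int q * int k * (int k - 1) - 2 * (int k - 1) * int t"
proof -
  obtain k' where k: "k = Suc k'"
    using assms(3) by (cases k) auto
  have "2 * int (sum_div q (k * q - t)) = 2 * int (sum_div q (k' * q + (q - t)))"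
    using assms(1) by (simp add: k add.commute)
  also have "\<dots> = int q * int k' * (int k' - 1) + 2 * int k' * int (q - t)"
    using assms(2) by (intro sum_div_eq) auto
  also have "\<dots> = int q * int k * (int k - 1) - 2 * (int k - 1) * int t"
    using assms(1) by (simp add: k of_nat_diff) (simp add: algebra_simps)
  finally show ?thesis .
qed

text \<open>
  The contribution of \<open>q\<close> to the \<open>p\<close>-adic valuation of the number of plane partitions in an
  \<open>a \<times> b \<times> c\<close> box, symmetric in the three sides.
\<close>

definition box_valuation :: "nat \<Rightarrow> nat \<Rightarrow> nat \<Rightarrow> nat \<Rightarrow> int" where
  "box_valuation q a b c =
     int (sum_div q (a + b + c)) - int (sum_div q (a + b)) - int (sum_div q (a + c))
       - int (sum_div q (b + c)) + int (sum_div q a) + int (sum_div q b) + int (sum_div q c)"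

text \<open>
  The arguments of \<open>sum_div\<close> lie in the blocks that start at \<open>kq\<close>, \<open>2kq\<close> and \<open>3kq\<close>, and the alternating sum
  of the linear expressions valid there cancels.
\<close>

lemma box_valuation_eq_0_low:
  assumes "q > 0" "a = k * q + x" "b = k * q + y" "c = k * q + z" "x + y + z \<le> q"
  shows "box_valuation q a b c = 0"
proof -
  have args: "a + b + c = (3 * k) * q + (x + y + z)" "a + b = (2 * k) * q + (x + y)"
    "a + c = (2 * k) * q + (x + z)" "b + c = (2 * k) * q + (y + z)"
    using assms by (auto simp: algebra_simps)
  have "2 * int (sum_div q (a + b + c)) = int q * int (3 * k) * (int (3 * k) - 1) + 2 * int (3 * k) * int (x + y + z)"
    using sum_div_eq[of "x + y + z" q "3 * k"] assms(1,5) unfolding args(1) by simp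
  moreover have "2 * int (sum_div q (a + b)) = int q * int (2 * k) * (int (2 * k) - 1) + 2 * int (2 * k) * int (x + y)"
    using sum_div_eq[of "x + y" q "2 * k"] assms(1,5) unfolding args(2) by simp
  moreover have "2 * int (sum_div q (a + c)) = int q * int (2 * k) * (int (2 * k) - 1) + 2 * int (2 * k) * int (x + z)"
    using sum_div_eq[of "x + z" q "2 * k"] assms(1,5) unfolding args(3) by simp
  moreover have "2 * int (sum_div q (b + c)) = int q * int (2 * k) * (int (2 * k) - 1) + 2 * int (2 * k) * int (y + z)"
    using sum_div_eq[of "y + z" q "2 * k"] assms(1,5) unfolding args(4) by simp
  moreover have "2 * int (sum_div q (a)) = int q * int (k) * (int (k) - 1) + 2 * int (k) * int (x)"
    using sum_div_eq[of "x" q "k"] assms(1,5) unfolding assms(2) by simp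
  moreover have "2 * int (sum_div q (b)) = int q * int (k) * (int (k) - 1) + 2 * int (k) * int (y)"
    using sum_div_eq[of "y" q "k"] assms(1,5) unfolding assms(3) by simp
  moreover have "2 * int (sum_div q (c)) = int q * int (k) * (int (k) - 1) + 2 * int (k) * int (z)"
    using sum_div_eq[of "z" q "k"] assms(1,5) unfolding assms(4) by simp
  ultimately have "2 * box_valuation q a b c = 0"
    by (simp add: box_valuation_def algebra_simps)
  then show ?thesis
    by simp
qed

lemma box_valuation_eq_0_high:
  assumes "q > 0" "k > 0" "a = k * q - x" "b = k * q - y" "c = k * q - z" "x + y + z \<le> q"
  shows "box_valuation q a b c = 0"
proof -
  define w where "w = k * q"
  have w: "q \<le> w" "3 * k * q = 3 * w" "2 * k * q = 2 * w"
    using assms(2) by (simp_all add: w_def)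
  have args: "a + b + c = (3 * k) * q - (x + y + z)" "a + b = (2 * k) * q - (x + y)"
    "a + c = (2 * k) * q - (x + z)" "b + c = (2 * k) * q - (y + z)"
    unfolding w(2,3) using assms(3-6) w(1) by (simp_all flip: w_def)
  have "2 * int (sum_div q (a + b + c)) = int q * int (3 * k) * (int (3 * k) - 1) - 2 * (int (3 * k) - 1) * int (x + y + z)"
    using sum_div_eq'[of "x + y + z" q "3 * k"] assms(1,2,6) unfolding args(1) by simp
  moreover have "2 * int (sum_div q (a + b)) = int q * int (2 * k) * (int (2 * k) - 1) - 2 * (int (2 * k) - 1) * int (x + y)"
    using sum_div_eq'[of "x + y" q "2 * k"] assms(1,2,6) unfolding args(2) by simp
  moreover have "2 * int (sum_div q (a + c)) = int q * int (2 * k) * (int (2 * k) - 1) - 2 * (int (2 * k) - 1) * int (x + z)"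
    using sum_div_eq'[of "x + z" q "2 * k"] assms(1,2,6) unfolding args(3) by simp
  moreover have "2 * int (sum_div q (b + c)) = int q * int (2 * k) * (int (2 * k) - 1) - 2 * (int (2 * k) - 1) * int (y + z)"
    using sum_div_eq'[of "y + z" q "2 * k"] assms(1,2,6) unfolding args(4) by simp
  moreover have "2 * int (sum_div q (a)) = int q * int (k) * (int (k) - 1) - 2 * (int (k) - 1) * int (x)"
    using sum_div_eq'[of "x" q "k"] assms(1,2,6) unfolding assms(3) by simp
  moreover have "2 * int (sum_div q (b)) = int q * int (k) * (int (k) - 1) - 2 * (int (k) - 1) * int (y)"
    using sum_div_eq'[of "y" q "k"] assms(1,2,6) unfolding assms(4) by simp
  moreover have "2 * int (sum_div q (c)) = int q * int (k) * (int (k) - 1) - 2 * (int (k) - 1) * int (z)"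
    using sum_div_eq'[of "z" q "k"] assms(1,2,6) unfolding assms(5) by simp
  ultimately have "2 * box_valuation q a b c = 0"
    by (simp add: box_valuation_def algebra_simps)
  then show ?thesis
    by simp
qed

text \<open>
  Nearly equal sides have the form \<open>kq + x\<close> with a common \<open>k\<close> and \<open>x \<le> q\<close>. The
  hypothesis says that the sum of the three remainders is at most \<open>q\<close> or at least \<open>2q\<close>. In the second
  case the sides are measured downwards from the next multiple of \<open>q\<close>, and then the
  distances add up to at most \<open>q\<close>.
\<close>

lemma box_valuation_eq_0:
  assumes "q > 0" "a \<in> {r, Suc r}" "b \<in> {r, Suc r}" "c \<in> {r, Suc r}"
    and no: "\<And>k. \<not> ((3 * k + 1) * q < a + b + c \<and> a + b + c < (3 * k + 2) * q)"
  shows "box_valuation q a b c = 0"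
proof -
  define k t where "k = r div q" and "t = r mod q"
  have r: "r = k * q + t" and t: "t < q"
    using assms(1) by (auto simp: k_def t_def)
  define x y z where "x = a - k * q" and "y = b - k * q" and "z = c - k * q"
  have xyz: "a = k * q + x" "b = k * q + y" "c = k * q + z" "x \<le> q" "y \<le> q" "z \<le> q"
    using assms(2-4) r t by (auto simp: x_def y_def z_def)
  have "a + b + c = 3 * k * q + (x + y + z)"
    using xyz by simp
  with no[of k] have "x + y + z \<le> q \<or> 2 * q \<le> x + y + z"
    by (auto simp: algebra_simps)
  then show ?thesis
  proof
    assume "x + y + z \<le> q"
    then show ?thesis
      by (rule box_valuation_eq_0_low[OF assms(1) xyz(1-3)])
  next
    assume *: "2 * q \<le> x + y + z"
    have "a = Suc k * q - (q - x)" "b = Suc k * q - (q - y)" "c = Suc k * q - (q - z)"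
      using xyz by simp_all
    then show ?thesis
      by (rule box_valuation_eq_0_high[OF assms(1) zero_less_Suc]) (use * xyz(4-6) in simp_all)
  qed
qed

lemma det_toeplitz_binomial_not_dvd:
  assumes p: "prime p"
    and v: "\<And>e. e \<ge> 1 \<Longrightarrow> box_valuation (p ^ e) n a b = 0"
  shows "\<not> int p dvd det (mat n n (\<lambda>(i, j). int (toeplitz_binomial (a + b) a i j)))"
proof -
  define D where "D = nat \<bar>det (mat n n (\<lambda>(i, j). int (toeplitz_binomial (a + b) a i j)))\<bar>"
  define P Q where "P = (\<Prod>i<n. fact (a + i) * fact (b + i) :: nat)"
    and "Q = (\<Prod>i<n. fact (a + b + i) * fact i :: nat)"
  have "int (P * D) = \<bar>int P * det (mat n n (\<lambda>(i, j). int (toeplitz_binomial (a + b) a i j)))\<bar>"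
    by (simp add: D_def abs_mult)
  also have "\<dots> = \<bar>int Q\<bar>"
    using det_toeplitz_binomial[of a b n] by (simp add: P_def Q_def)
  finally have PDQ: "P * D = Q"
    by (simp only: abs_of_nat of_nat_eq_iff)
  define K where "K = a + b + n"
  have mult_prod: "multiplicity p (\<Prod>i<n. fact (f i) * fact (g i) :: nat) =
      (\<Sum>e\<in>{1..K}. \<Sum>i<n. f i div p ^ e + g i div p ^ e)"
    if "\<And>i. i < n \<Longrightarrow> f i \<le> K \<and> g i \<le> K" for f g
  proof -
    have "multiplicity p (\<Prod>i<n. fact (f i) * fact (g i) :: nat) =
        (\<Sum>i<n. multiplicity p (fact (f i) * fact (g i) :: nat))"
      using p by (intro prime_elem_multiplicity_prod_distrib) auto
    also have "\<dots> = (\<Sum>i<n. \<Sum>e\<in>{1..K}. f i div p ^ e + g i div p ^ e)"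
      using p that
      by (intro sum.cong refl)
        (simp add: prime_elem_multiplicity_mult_distrib multiplicity_fact_legendre[of p _ K] sum.distrib)
    finally show ?thesis
      by (subst sum.swap)
  qed
  have vals: "(\<Sum>i<n. (a + i) div p ^ e + (b + i) div p ^ e) =
      (\<Sum>i<n. (a + b + i) div p ^ e + i div p ^ e)" if "e \<ge> 1" for e
  proof -
    let ?S = "sum_div (p ^ e)"
    have "int (?S (a + b + n)) + int (?S n) + int (?S a) + int (?S b) =
        int (?S (a + n)) + int (?S (b + n)) + int (?S (a + b))"
      using v[OF that] unfolding box_valuation_def by (simp add: add_ac)
    then have "?S (a + b + n) + ?S n + ?S a + ?S b = ?S (a + n) + ?S (b + n) + ?S (a + b)"
      by linarith
    then have "(?S (a + n) - ?S a) + (?S (b + n) - ?S b) = (?S (a + b + n) - ?S (a + b)) + ?S n"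
      using sum_div_mono[of "p ^ e" "a + b" n] sum_div_mono[of "p ^ e" a n]
        sum_div_mono[of "p ^ e" b n] by linarith
    then show ?thesis
      unfolding sum.distrib sum_div_shift sum_div_def[of _ n] .
  qed
  have "multiplicity p P = (\<Sum>e\<in>{1..K}. \<Sum>i<n. (a + i) div p ^ e + (b + i) div p ^ e)"
    unfolding P_def by (rule mult_prod) (simp add: K_def)
  also have "\<dots> = (\<Sum>e\<in>{1..K}. \<Sum>i<n. (a + b + i) div p ^ e + i div p ^ e)"
    by (rule sum.cong[OF refl], rule vals) simp
  also have "\<dots> = multiplicity p Q"
    unfolding Q_def by (rule mult_prod[symmetric]) (simp add: K_def)
  finally have "multiplicity p P = multiplicity p Q" .
  moreover have "Q \<noteq> 0"
    by (simp add: Q_def)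
  with PDQ have "P \<noteq> 0" "D \<noteq> 0"
    by auto
  then have "multiplicity p (P * D) = multiplicity p P + multiplicity p D"
    using p by (intro prime_elem_multiplicity_mult_distrib) auto
  ultimately have "multiplicity p D = 0"
    using PDQ by simp
  then have "\<not> p dvd D"
    using p \<open>D \<noteq> 0\<close> by (subst (asm) multiplicity_eq_zero_iff) (auto dest: not_prime_unit)
  then show ?thesis
    by (simp add: D_def nat_abs_dvd_iff)
qed

section \<open>Binomial Toeplitz systems over a field\<close>

lemma coeff_one_plus_X_power: "Polynomial.coeff ([:1, 1::'a::comm_ring_1:] ^ m) i = of_nat (m choose i)"
proof (cases "i \<le> m")
  case True
  then show ?thesis
    by (simp add: coeff_linear_poly_power)
next
  case False
  have "Polynomial.degree ([:1, 1::'a:] ^ m) \<le> 1 * m"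
    by (rule order_trans[OF degree_power_le]) simp
  with False show ?thesis
    by (simp add: coeff_eq_0 binomial_eq_0)
qed

lemma coeff_mult_one_plus_X_power:
  fixes c :: "'a::comm_ring_1 poly"
  assumes "\<And>i. n \<le> i \<Longrightarrow> Polynomial.coeff c i = 0"
  shows "Polynomial.coeff (c * [:1, 1:] ^ m) (a + i) =
    (\<Sum>j<n. of_nat (toeplitz_binomial m a i j) * Polynomial.coeff c j)"
proof -
  have "Polynomial.coeff (c * [:1, 1:] ^ m) (a + i) =
      (\<Sum>j\<le>a + i. of_nat (toeplitz_binomial m a i j) * Polynomial.coeff c j)"
    by (simp add: coeff_mult coeff_one_plus_X_power toeplitz_binomial_def mult.commute)
  also have "\<dots> = (\<Sum>j\<in>{..a + i} \<union> {..<n}. of_nat (toeplitz_binomial m a i j) * Polynomial.coeff c j)"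
    by (intro sum.mono_neutral_left) (auto simp: toeplitz_binomial_def)
  also have "\<dots> = (\<Sum>j<n. of_nat (toeplitz_binomial m a i j) * Polynomial.coeff c j)"
    by (intro sum.mono_neutral_right) (auto simp: assms)
  finally show ?thesis .
qed

lemma toeplitz_kernel_trivial:
  fixes c :: "'a::field poly"
  assumes "\<not> int CHAR('a) dvd det (mat n n (\<lambda>(i, j). int (toeplitz_binomial m a i j)))"
    and deg: "\<And>i. n \<le> i \<Longrightarrow> Polynomial.coeff c i = 0"
    and gap: "\<And>i. i < n \<Longrightarrow> Polynomial.coeff (c * [:1, 1:] ^ m) (a + i) = 0"
  shows "c = 0"
proof -
  define M where "M = mat n n (\<lambda>(i, j). int (toeplitz_binomial m a i j))"
  define N :: "'a mat" where "N = map_mat of_int M"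
  have "det N = of_int (det M)"
    unfolding N_def by (rule of_int_hom.hom_det)
  moreover have "of_int (det M) \<noteq> (0 :: 'a)"
    using assms(1) by (simp add: M_def of_int_eq_0_iff_char_dvd)
  ultimately have "det N \<noteq> 0"
    by simp
  define v where "v = vec n (\<lambda>j. Polynomial.coeff c j)"
  have "N *\<^sub>v v = 0\<^sub>v n"
    using gap by (intro eq_vecI)
      (auto simp: N_def M_def v_def scalar_prod_def atLeast0LessThan
        coeff_mult_one_plus_X_power[of n c, OF deg])
  moreover have "N \<in> carrier_mat n n" "v \<in> carrier_vec n"
    by (simp_all add: N_def M_def v_def)
  ultimately have "v = 0\<^sub>v n"
    using \<open>det N \<noteq> 0\<close> det_0_iff_vec_prod_zero_field[of N n] by blast
  then have "Polynomial.coeff c j = 0" if "j < n" for j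
    using that by (metis index_vec index_zero_vec(1) v_def)
  with deg show ?thesis
    by (intro poly_eqI) (metis coeff_0 not_le)
qed

text \<open>
  There are \<open>k + 1\<close> unknown coefficients and \<open>k\<close> equations; a zero row makes the matrix square and
  singular.
\<close>

lemma exists_toeplitz_kernel:
  "\<exists>c :: 'a::field poly. c \<noteq> 0 \<and> (\<forall>i>k. Polynomial.coeff c i = 0) \<and>
     (\<forall>i<k. Polynomial.coeff (c * [:1, 1:] ^ m) (a + i) = 0)"
proof -
  define N :: "'a mat" where
    "N = mat (Suc k) (Suc k) (\<lambda>(i, j). if i < k then of_nat (toeplitz_binomial m a i j) else 0)"
  have N: "N \<in> carrier_mat (Suc k) (Suc k)"
    by (simp add: N_def)
  have "det N = 0"
    unfolding det_def'[OF N]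
  proof (intro sum.neutral ballI)
    fix \<pi> assume "\<pi> \<in> {\<pi>. \<pi> permutes {0..<Suc k}}"
    then have "\<pi> k < Suc k"
      using permutes_in_image[of \<pi> "{0..<Suc k}" k] by auto
    then have "(\<Prod>i = 0..<Suc k. N $$ (i, \<pi> i)) = 0"
      by (intro prod_zero bexI[of _ k]) (auto simp: N_def)
    then show "signof \<pi> * (\<Prod>i = 0..<Suc k. N $$ (i, \<pi> i)) = 0"
      by simp
  qed
  then obtain v where v: "v \<in> carrier_vec (Suc k)" "v \<noteq> 0\<^sub>v (Suc k)" "N *\<^sub>v v = 0\<^sub>v (Suc k)"
    using det_0_iff_vec_prod_zero_field[OF N] by blast
  define c where "c = (\<Sum>j<Suc k. Polynomial.monom (v $ j) j)"
  have c: "Polynomial.coeff c j = (if j < Suc k then v $ j else 0)" for j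
    by (auto simp: c_def coeff_sum coeff_monom when_def if_distrib cong: if_cong)
  have "c \<noteq> 0"
  proof
    assume "c = 0"
    then have "v $ j = 0" if "j < Suc k" for j
      using that c[of j] by simp
    then have "v = 0\<^sub>v (Suc k)"
      using v(1) by (intro eq_vecI) auto
    with v(2) show False
      by simp
  qed
  moreover have "Polynomial.coeff (c * [:1, 1:] ^ m) (a + i) = 0" if "i < k" for i
  proof -
    have "Polynomial.coeff (c * [:1, 1:] ^ m) (a + i) =
        (\<Sum>j<Suc k. of_nat (toeplitz_binomial m a i j) * Polynomial.coeff c j)"
      by (rule coeff_mult_one_plus_X_power) (simp add: c)
    also have "\<dots> = (N *\<^sub>v v) $ i"
      using that v(1) by (simp add: N_def c scalar_prod_def atLeast0LessThan)
    finally show ?thesis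
      using v(3) that by simp
  qed
  ultimately show ?thesis
    by (intro exI[of _ c]) (auto simp: c)
qed

text \<open>
  Such a \<open>c\<close> is the third coefficient of a relation \<open>x\<^sup>d a + b + (1 + x)\<^sup>d c = 0\<close> whose coefficients all
  have degree less than \<open>d div 2\<close>: the gap in \<open>(1 + x)\<^sup>d c\<close> separates \<open>x\<^sup>d a\<close> from \<open>b\<close>.
\<close>

definition low_syzygy :: "nat \<Rightarrow> 'a::field poly \<Rightarrow> bool" where
  "low_syzygy d c \<longleftrightarrow> c \<noteq> 0 \<and> (\<forall>i \<ge> d div 2. Polynomial.coeff c i = 0) \<and>
     (\<forall>i. d div 2 \<le> i \<and> i < d \<longrightarrow> Polynomial.coeff (c * [:1, 1:] ^ d) i = 0)"

lemma low_syzygy_pos: "low_syzygy d C \<Longrightarrow> d div 2 > 0"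
  by (rule ccontr) (auto simp: low_syzygy_def poly_eq_iff)

text \<open>
  The inequalities of the theorem with cleared denominators. In this form they do not depend on
  the parity of \<open>d\<close>.
\<close>

definition resonant :: "nat \<Rightarrow> nat \<Rightarrow> bool" where
  "resonant d q \<longleftrightarrow> (\<exists>k. (3 * k + 1) * q < d + d div 2 \<and> d + Suc d div 2 < (3 * k + 2) * q)"

section \<open>Existence of low syzygies\<close>

lemma split_at_gap:
  fixes P :: "'a::comm_ring_1 poly"
  assumes "\<And>i. k < i \<Longrightarrow> i < u \<Longrightarrow> Polynomial.coeff P i = 0"
  obtains a b where "P = Polynomial.monom 1 u * a + b" "Polynomial.degree b \<le> k"
    "\<And>n. Polynomial.degree P \<le> u + n \<Longrightarrow> Polynomial.degree a \<le> n"
proof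
  show "P = Polynomial.monom 1 u * poly_shift u P + poly_cutoff u P"
    by (rule poly_eqI) (auto simp: coeff_monom_mult coeff_poly_shift coeff_poly_cutoff)
  show "Polynomial.degree (poly_cutoff u P) \<le> k"
    by (rule degree_le) (auto simp: coeff_poly_cutoff assms)
  show "Polynomial.degree (poly_shift u P) \<le> n" if "Polynomial.degree P \<le> u + n" for n
    using that by (intro degree_le) (auto simp: coeff_poly_shift intro!: coeff_eq_0)
qed

text \<open>
  Start from a relation for the exponent \<open>u = 2k + 1\<close> with coefficients of degree at most \<open>k\<close> and raise it to
  the \<open>q\<close>-th power, which is additive in characteristic \<open>p\<close>. If \<open>d\<close> is at most \<open>uq\<close>, the surplus
  factors \<open>x\<close> and \<open>1 + x\<close> of the powers are absorbed into the coefficients. Otherwise the relation is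
  multiplied by a power of \<open>x (1 + x)\<close>. The two resonance inequalities bound the degrees in the two cases.
\<close>

lemma resonant_imp_low_syzygy:
  assumes "prime CHAR('a)" "resonant d (CHAR('a) ^ n)"
  shows "\<exists>c :: 'a::field poly. low_syzygy d c"
proof -
  define q where "q = CHAR('a) ^ n"
  define h where "h = d div 2"
  have "q > 0"
    using assms(1) by (simp add: q_def prime_gt_0_nat)
  obtain k where k: "(3 * k + 1) * q < d + h" "d + Suc d div 2 < (3 * k + 2) * q"
    using assms(2) by (auto simp: resonant_def q_def h_def)
  have hd: "Suc d div 2 + h = d"
    by (simp add: h_def)
  define u where "u = 2 * k + 1"
  obtain c0 :: "'a poly" where c0: "c0 \<noteq> 0" "\<And>i. i > k \<Longrightarrow> Polynomial.coeff c0 i = 0"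
    "\<And>i. i < k \<Longrightarrow> Polynomial.coeff (c0 * [:1, 1:] ^ u) (k + 1 + i) = 0"
    using exists_toeplitz_kernel[of k u "k + 1"] by blast
  have "Polynomial.coeff (c0 * [:1, 1:] ^ u) i = 0" if "k < i" "i < u" for i
    using c0(3)[of "i - (k + 1)"] that by (simp add: u_def)
  then obtain a0 b0 where ab0: "c0 * [:1, 1:] ^ u = Polynomial.monom 1 u * a0 + b0"
      "Polynomial.degree b0 \<le> k"
    using split_at_gap by metis
  define a b c where "a = a0 ^ q" and "b = b0 ^ q" and "c = c0 ^ q"
  have "(c0 * [:1, 1:] ^ u) ^ q = (Polynomial.monom 1 u * a0) ^ q + b0 ^ q"
    unfolding ab0(1) using assms(1) by (intro freshmans_dream'[of q n]) (simp_all add: q_def)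
  then have abc: "c * [:1, 1:] ^ (u * q) = Polynomial.monom 1 (u * q) * a + b"
    by (simp add: a_def b_def c_def power_mult_distrib monom_power power_mult)
  have "Polynomial.degree c0 \<le> k"
    using c0(2) by (intro degree_le) auto
  then have deg_c: "Polynomial.degree c \<le> k * q"
    unfolding c_def by (intro order_trans[OF degree_power_le] mult_le_mono1)
  have deg_b: "Polynomial.degree b \<le> k * q"
    unfolding b_def using ab0(2) by (intro order_trans[OF degree_power_le] mult_le_mono1)
  have "c \<noteq> 0"
    using c0(1) by (simp add: c_def)
  have deg_pow: "Polynomial.degree ([:1, 1 :: 'a:] ^ e) \<le> e" for e
    by (rule order_trans[OF degree_power_le]) simp
  define w where "w = k * q"
  have k': "3 * w + q < d + h" "d + Suc d div 2 < 3 * w + 2 * q" and uq: "u * q = 2 * w + q"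
    using k by (simp_all add: w_def u_def algebra_simps)
  show ?thesis
  proof (cases "d \<le> u * q")
    case True
    define C where "C = c * [:1, 1:] ^ (u * q - d)"
    have "Polynomial.degree C \<le> w + (u * q - d)"
      unfolding C_def using deg_c deg_pow[of "u * q - d"]
      by (intro order_trans[OF degree_mult_le]) (simp add: w_def)
    also have "\<dots> < h"
      using k' True uq by linarith
    finally have deg_C: "Polynomial.degree C < h" .
    have "C * [:1, 1:] ^ d = Polynomial.monom 1 (u * q) * a + b"
      unfolding C_def abc[symmetric] using True by (simp add: mult.assoc flip: power_add)
    moreover have "w < h"
      using k' True uq by linarith
    ultimately have "Polynomial.coeff (C * [:1, 1:] ^ d) i = 0" if "h \<le> i" "i < d" for i
      using that True deg_b by (simp add: coeff_monom_mult coeff_eq_0 w_def)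
    moreover have "C \<noteq> 0"
      using \<open>c \<noteq> 0\<close> by (simp add: C_def)
    ultimately have "low_syzygy d C"
      using deg_C by (auto simp: low_syzygy_def h_def intro: coeff_eq_0)
    then show ?thesis ..
  next
    case False
    define e where "e = d - u * q"
    have d: "d = u * q + e"
      using False by (simp add: e_def)
    define C where "C = c * Polynomial.monom 1 e"
    have less_h: "w + e + e < h"
      using k' d uq hd by linarith
    have "Polynomial.degree C \<le> w + e"
      unfolding C_def using deg_c
      by (intro order_trans[OF degree_mult_le]) (simp add: w_def degree_monom_eq)
    with less_h have deg_C: "Polynomial.degree C < h"
      by simp
    define B where "B = b * [:1, 1:] ^ e * Polynomial.monom 1 e"
    have "Polynomial.degree B \<le> w + e + e"
      unfolding B_def using deg_b deg_pow[of e]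
      by (intro order_trans[OF degree_mult_le] add_mono) (simp_all add: w_def degree_monom_eq)
    with less_h have deg_B: "Polynomial.degree B < h"
      by simp
    have "C * [:1, 1:] ^ d = (c * [:1, 1:] ^ (u * q)) * [:1, 1:] ^ e * Polynomial.monom 1 e"
      by (simp add: C_def d power_add mult_ac)
    also have "\<dots> = Polynomial.monom 1 d * (a * [:1, 1:] ^ e) + B"
      unfolding abc B_def d by (simp add: algebra_simps mult_monom)
    finally have "Polynomial.coeff (C * [:1, 1:] ^ d) i = 0" if "h \<le> i" "i < d" for i
      using that deg_B by (simp add: coeff_monom_mult coeff_eq_0)
    moreover have "C \<noteq> 0"
      using \<open>c \<noteq> 0\<close> by (simp add: C_def)
    ultimately have "low_syzygy d C"
      using deg_C by (auto simp: low_syzygy_def h_def intro: coeff_eq_0)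
    then show ?thesis ..
  qed
qed

text \<open>
  If no power of \<open>p\<close> resonates with \<open>d\<close>, the determinants of the relevant boxes are prime to \<open>p\<close>. For odd
  \<open>d = 2r + 1\<close> the absence of resonance is slightly weaker than what \<open>box_valuation_eq_0\<close> requires of
  either box: for \<open>r \<times> r \<times> (r + 1)\<close> the value \<open>3r + 2 = (3k + 2)q\<close> has to be excluded, and for
  \<open>r \<times> (r + 1) \<times> (r + 1)\<close> the value \<open>3r + 1 = (3k + 1)q\<close>. Since \<open>p\<close> divides \<open>q\<close> but not both
  \<open>3r + 1\<close> and \<open>3r + 2\<close>, at least one of the two exclusions is automatic.
\<close>

lemma low_syzygy_imp_resonant:
  fixes c :: "'a::field poly"
  assumes p: "prime CHAR('a)" and c: "low_syzygy d c"
  shows "\<exists>n\<ge>1. resonant d (CHAR('a) ^ n)"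
proof (rule ccontr)
  define p where "p = CHAR('a)"
  assume "\<not> ?thesis"
  then have non: "\<not> ((3 * k + 1) * p ^ n < d + d div 2 \<and> d + Suc d div 2 < (3 * k + 2) * p ^ n)"
    if "n \<ge> 1" for n k
    using that unfolding resonant_def p_def by blast
  have pos: "p ^ n > 0" for n
    using p by (simp add: p_def prime_gt_0_nat)
  have kernel: "D = 0"
    if "\<And>n. n \<ge> 1 \<Longrightarrow> box_valuation (p ^ n) N a b = 0" "\<And>i. N \<le> i \<Longrightarrow> Polynomial.coeff D i = 0"
      "\<And>i. i < N \<Longrightarrow> Polynomial.coeff (D * [:1, 1:] ^ (a + b)) (a + i) = 0"
    for N a b and D :: "'a poly"
    using det_toeplitz_binomial_not_dvd[OF p, of N a b] that(1)
    by (intro toeplitz_kernel_trivial[of N "a + b" a D] that(2,3)) (simp add: p_def)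
  have box: "box_valuation (p ^ n) N a b = 0"
    if "N \<in> {r, Suc r}" "a \<in> {r, Suc r}" "b \<in> {r, Suc r}"
      "\<And>k. \<not> ((3 * k + 1) * p ^ n < N + a + b \<and> N + a + b < (3 * k + 2) * p ^ n)" for n N a b r
    using that pos by (intro box_valuation_eq_0[of _ _ r])
  have c0: "c \<noteq> 0" and deg: "\<And>i. d div 2 \<le> i \<Longrightarrow> Polynomial.coeff c i = 0"
    and gap: "\<And>i. d div 2 \<le> i \<Longrightarrow> i < d \<Longrightarrow> Polynomial.coeff (c * [:1, 1:] ^ d) i = 0"
    using c by (auto simp: low_syzygy_def)
  have "c = 0"
  proof (cases "even d")
    case True
    then obtain r where r: "d = 2 * r"
      by (elim evenE)
    show ?thesis
    proof (rule kernel[of r r r])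
      show "box_valuation (p ^ n) r r r = 0" if "n \<ge> 1" for n
      proof (rule box[of _ r])
        fix k
        show "\<not> ((3 * k + 1) * p ^ n < r + r + r \<and> r + r + r < (3 * k + 2) * p ^ n)"
          \<comment> \<open>Both thresholds of resonance are \<open>3r\<close>, the sum of the sides.\<close>
          using non[OF that, of k] by (simp add: r) linarith
      qed auto
    qed (use deg gap in \<open>auto simp: r mult_2\<close>)
  next
    case False
    then obtain r where r: "d = Suc (2 * r)"
      by (auto elim: oddE)
    show ?thesis
    proof (cases "p dvd 3 * r + 2")
      case False
      have ndvd: "3 * r + 2 \<noteq> (3 * k + 2) * p ^ n" if "n \<ge> 1" for n k
        using False that by (metis dvd_mult dvd_power not_gr_zero not_one_le_zero dvd_triv_right dvd_trans)
      show ?thesis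
      proof (rule kernel[of r r "Suc r"])
        show "box_valuation (p ^ n) r r (Suc r) = 0" if "n \<ge> 1" for n
        proof (rule box[of _ r])
          fix k
          show "\<not> ((3 * k + 1) * p ^ n < r + r + Suc r \<and> r + r + Suc r < (3 * k + 2) * p ^ n)"
            using non[OF that, of k] ndvd[OF that, of k] by (simp add: r) linarith
        qed auto
      qed (use deg gap in \<open>auto simp: r mult_2\<close>)
    next
      case True
      have "\<not> p dvd 3 * r + 1"
      proof
        assume "p dvd 3 * r + 1"
        with True have "p dvd (3 * r + 2) - (3 * r + 1)"
          by (rule dvd_diff_nat)
        with p show False
          by (simp add: p_def)
      qed
      then have ndvd: "3 * r + 1 \<noteq> (3 * k + 1) * p ^ n" if "n \<ge> 1" for n k
        using that by (metis dvd_mult dvd_power not_gr_zero not_one_le_zero dvd_triv_right dvd_trans)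
      have step: "Polynomial.coeff ([:1, 1:] * P) (Suc i) = Polynomial.coeff P (Suc i) + Polynomial.coeff P i"
        for P :: "'a poly" and i
        by simp
      show ?thesis
      proof (rule kernel[of r "Suc r" "Suc r"])
        show "box_valuation (p ^ n) r (Suc r) (Suc r) = 0" if "n \<ge> 1" for n
        proof (rule box[of _ r])
          fix k
          show "\<not> ((3 * k + 1) * p ^ n < r + Suc r + Suc r \<and> r + Suc r + Suc r < (3 * k + 2) * p ^ n)"
            using non[OF that, of k] ndvd[OF that, of k] by (simp add: r) linarith
        qed auto
        fix i assume "i < r"
        have "Suc r + Suc r = Suc d"
          by (simp add: r)
        then have "c * [:1, 1:] ^ (Suc r + Suc r) = [:1, 1:] * (c * [:1, 1:] ^ d)"
          by (simp only: power_Suc mult_ac)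
        then show "Polynomial.coeff (c * [:1, 1:] ^ (Suc r + Suc r)) (Suc r + i) = 0"
          using \<open>i < r\<close> gap[of "Suc r + i"] gap[of "r + i"] step[of _ "r + i"] by (simp add: r)
      qed (use deg in \<open>auto simp: r\<close>)
    qed
  qed
  with c0 show False ..
qed

section \<open>The transposed system\<close>

text \<open>
  This is the equality of row rank and column rank in the case of full row rank. Induction on the rows: let \<open>e t\<close> be
  preimages of the unit vectors for the old rows. Subtracting a combination of them from a suitable unit vector
  gives a vector \<open>u\<close> that is killed by the old rows but not by the new one.
\<close>

lemma rows_independent_imp_onto:
  fixes M :: "'i \<Rightarrow> 'j \<Rightarrow> 'a::field"
  assumes "finite I" "finite J"
    and "\<And>v. (\<forall>j\<in>J. (\<Sum>i\<in>I. v i * M i j) = 0) \<Longrightarrow> \<forall>i\<in>I. v i = 0"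
  shows "\<exists>x. \<forall>i\<in>I. (\<Sum>j\<in>J. M i j * x j) = w i"
  using assms(1,3)
proof (induction I arbitrary: w rule: finite_induct)
  case (insert s I)
  have "\<forall>i\<in>I. v i = 0" if v: "\<forall>j\<in>J. (\<Sum>i\<in>I. v i * M i j) = 0" for v
  proof -
    have "(\<Sum>i\<in>insert s I. (v(s := 0)) i * M i j) = (\<Sum>i\<in>I. v i * M i j)" for j
      using insert.hyps by (auto intro!: sum.cong)
    with v insert.prems[of "v(s := 0)"] have "\<forall>i\<in>insert s I. (v(s := 0)) i = 0"
      by simp
    then show ?thesis
      using insert.hyps(2) by (metis fun_upd_other insertCI)
  qed
  then have IH: "\<exists>x. \<forall>i\<in>I. (\<Sum>j\<in>J. M i j * x j) = w i" for w
    by (rule insert.IH)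
  then have "\<forall>t. \<exists>x. \<forall>i\<in>I. (\<Sum>j\<in>J. M i j * x j) = (if i = t then 1 else 0)"
    by (intro allI IH)
  then obtain e where e: "\<And>t i. i \<in> I \<Longrightarrow> (\<Sum>j\<in>J. M i j * e t j) = (if i = t then 1 else 0)"
    by metis
  \<comment> \<open>The combination of the rows that vanishes on all of the vectors \<open>e i\<close>.\<close>
  define v where "v = (\<lambda>i. if i = s then 1 else - (\<Sum>j\<in>J. M s j * e i j))"
  have "v s \<noteq> 0"
    by (simp add: v_def)
  then obtain t where t: "t \<in> J" "(\<Sum>i\<in>insert s I. v i * M i t) \<noteq> 0"
    using insert.prems by blast
  define u where "u = (\<lambda>j. (if j = t then 1 else 0) - (\<Sum>i\<in>I. M i t * e i j))"
  have Mu: "(\<Sum>j\<in>J. M r j * u j) = M r t - (\<Sum>i\<in>I. M i t * (\<Sum>j\<in>J. M r j * e i j))" for r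
  proof -
    have "(\<Sum>j\<in>J. M r j * u j) =
        (\<Sum>j\<in>J. if j = t then M r t else 0) - (\<Sum>j\<in>J. \<Sum>i\<in>I. M i t * (M r j * e i j))"
      unfolding u_def sum_subtractf[symmetric]
      by (intro sum.cong) (auto simp: algebra_simps sum_distrib_left)
    also have "(\<Sum>j\<in>J. \<Sum>i\<in>I. M i t * (M r j * e i j)) = (\<Sum>i\<in>I. M i t * (\<Sum>j\<in>J. M r j * e i j))"
      by (subst sum.swap) (simp add: sum_distrib_left)
    finally show ?thesis
      using t(1) assms(2) by simp
  qed
  have u_I: "(\<Sum>j\<in>J. M r j * u j) = 0" if "r \<in> I" for r
    using that insert.hyps(1) unfolding Mu by (simp add: e if_distrib cong: if_cong)
  have "(\<Sum>j\<in>J. M s j * u j) = (\<Sum>i\<in>insert s I. v i * M i t)"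
  proof -
    have "(\<Sum>i\<in>I. v i * M i t) = - (\<Sum>i\<in>I. M i t * (\<Sum>j\<in>J. M s j * e i j))"
      unfolding sum_negf[symmetric] using insert.hyps by (intro sum.cong) (auto simp: v_def)
    then show ?thesis
      using insert.hyps unfolding Mu by (simp add: v_def)
  qed
  with t(2) have u_s: "(\<Sum>j\<in>J. M s j * u j) \<noteq> 0"
    by simp
  obtain x where x: "\<forall>i\<in>I. (\<Sum>j\<in>J. M i j * x j) = w i"
    using IH by blast
  define z where "z = (w s - (\<Sum>j\<in>J. M s j * x j)) / (\<Sum>j\<in>J. M s j * u j)"
  have "(\<Sum>j\<in>J. M i j * (x j + z * u j)) = (\<Sum>j\<in>J. M i j * x j) + z * (\<Sum>j\<in>J. M i j * u j)" for i
    by (simp add: algebra_simps sum.distrib sum_distrib_left)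
  then have "\<forall>i\<in>insert s I. (\<Sum>j\<in>J. M i j * (x j + z * u j)) = w i"
    using x u_I u_s by (simp add: z_def)
  then show ?case
    by (rule exI[of _ "\<lambda>j. x j + z * u j"])
qed auto

text \<open>
  The coefficients of a vanishing linear combination of the rows of this system, read backwards, form a
  low syzygy. So the rows are independent.
\<close>

lemma no_low_syzygy_imp_middle_coeffs:
  assumes "\<And>c. \<not> low_syzygy d (c :: 'a::field poly)"
  shows "\<exists>C :: 'a poly. Polynomial.degree C \<le> d - 1 - d div 2 \<and>
    (\<forall>i. d - d div 2 \<le> i \<and> i < d \<longrightarrow> Polynomial.coeff (C * [:1, 1:] ^ d) i = w i)"
proof -
  define h where "h = d div 2"
  have h: "2 * h \<le> d"
    by (simp add: h_def)
  define e where "e = d - h"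
  have de: "d = e + h" and he: "h \<le> e"
    using h by (simp_all add: e_def)
  have "\<exists>x. \<forall>i\<in>{..<h}. (\<Sum>j\<in>{..<e}. of_nat (toeplitz_binomial d e i j) * x j) = w (e + i)"
  proof (rule rows_independent_imp_onto)
    fix v :: "nat \<Rightarrow> 'a"
    assume v: "\<forall>j\<in>{..<e}. (\<Sum>i\<in>{..<h}. v i * of_nat (toeplitz_binomial d e i j)) = 0"
    \<comment> \<open>The row with index \<open>h - 1 - i\<close> of the transposed system belongs to the coefficient of \<open>x\<^sup>i\<close>.\<close>
    define c where "c = (\<Sum>i<h. Polynomial.monom (v (h - 1 - i)) i)"
    have c: "Polynomial.coeff c i = (if i < h then v (h - 1 - i) else 0)" for i
      by (auto simp: c_def coeff_sum coeff_monom if_distrib cong: if_cong)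
    have "Polynomial.coeff (c * [:1, 1:] ^ d) l = 0" if l: "h \<le> l" "l < d" for l
    proof -
      define j where "j = d - 1 - l"
      have "j < e"
        using l de by (auto simp: j_def)
      have sym: "toeplitz_binomial d 0 l i = toeplitz_binomial d e (h - 1 - i) j" if "i < h" for i
      proof -
        have "l - i = e + (h - 1 - i) - j"
          using l that de by (auto simp: j_def)
        moreover have "j \<le> e + (h - 1 - i)" "i \<le> l"
          using l that de by (auto simp: j_def)
        ultimately show ?thesis
          by (simp add: toeplitz_binomial_def)
      qed
      have "Polynomial.coeff (c * [:1, 1:] ^ d) (0 + l) =
          (\<Sum>i<h. of_nat (toeplitz_binomial d 0 l i) * Polynomial.coeff c i)"
        by (rule coeff_mult_one_plus_X_power) (simp add: c)
      also have "\<dots> = (\<Sum>i<h. v (h - Suc i) * of_nat (toeplitz_binomial d e (h - Suc i) j))"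
        by (intro sum.cong) (auto simp: sym c)
      also have "\<dots> = (\<Sum>i<h. v i * of_nat (toeplitz_binomial d e i j))"
        by (rule sum.nat_diff_reindex)
      also have "\<dots> = 0"
        using v \<open>j < e\<close> by simp
      finally show ?thesis
        by simp
    qed
    then have "c = 0"
      using assms[of c] c by (auto simp: low_syzygy_def h_def)
    have "v i = Polynomial.coeff c (h - 1 - i)" if "i < h" for i
      using that by (simp add: c)
    with \<open>c = 0\<close> show "\<forall>i\<in>{..<h}. v i = 0"
      by simp
  qed auto
  then obtain x where x: "\<And>i. i < h \<Longrightarrow> (\<Sum>j<e. of_nat (toeplitz_binomial d e i j) * x j) = w (e + i)"
    by auto
  define C where "C = (\<Sum>j<e. Polynomial.monom (x j) j)"
  have C: "Polynomial.coeff C j = (if j < e then x j else 0)" for j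
    by (auto simp: C_def coeff_sum coeff_monom if_distrib cong: if_cong)
  have "Polynomial.degree C \<le> e - 1"
    by (rule degree_le) (auto simp: C)
  moreover have "Polynomial.coeff (C * [:1, 1:] ^ d) i = w i" if "e \<le> i" "i < d" for i
  proof -
    have "Polynomial.coeff (C * [:1, 1:] ^ d) (e + (i - e)) =
        (\<Sum>j<e. of_nat (toeplitz_binomial d e (i - e) j) * Polynomial.coeff C j)"
      by (rule coeff_mult_one_plus_X_power) (simp add: C)
    also have "\<dots> = w (e + (i - e))"
      using x[of "i - e"] that de by (simp add: C)
    finally show ?thesis
      using that by simp
  qed
  ultimately show ?thesis
    by (intro exI[of _ C]) (auto simp: e_def h_def diff_commute)
qed

section \<open>Polynomials in finitely many variables\<close>

lemma UNIV_three: "(UNIV :: 3 set) = {1, 2, 3}"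
proof -
  have "card {1, 2, 3 :: 3} = CARD(3)"
    by simp
  then show ?thesis
    by (intro card_subset_eq[symmetric]) auto
qed

lemma sum_three: "(\<Sum>i\<in>(UNIV :: 3 set). f i) = f 1 + f 2 + f 3"
  unfolding UNIV_three by (simp add: add_ac)

lemma prod_three: "(\<Prod>i\<in>(UNIV :: 3 set). f i) = f 1 * f 2 * f 3"
  unfolding UNIV_three by (simp add: mult_ac)

lemma all_three: "(\<forall>i :: 3. P i) \<longleftrightarrow> P 1 \<and> P 2 \<and> P 3"
  using UNIV_three by (metis UNIV_I empty_iff insert_iff)

lemma sum_single_lookup: "(\<Sum>t\<in>Poly_Mapping.keys f. Poly_Mapping.single t (Poly_Mapping.lookup f t)) = f"
  by (rule poly_mapping_eqI)
    (auto simp: lookup_sum lookup_single when_def in_keys_iff if_distrib cong: if_cong)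

text \<open>
  The \<open>K\<close>-algebra homomorphism to \<open>K[x]\<close> that maps the variable \<open>i\<close> to \<open>g i\<close>.
\<close>

definition subst_mpoly :: "('v \<Rightarrow> 'k poly) \<Rightarrow> ('v::finite, 'k::field) mpoly \<Rightarrow> 'k poly" where
  "subst_mpoly g f = (\<Sum>t\<in>Poly_Mapping.keys f.
     Polynomial.smult (Poly_Mapping.lookup f t) (\<Prod>i\<in>UNIV. g i ^ Poly_Mapping.lookup t i))"

lemma subst_mpoly_superset:
  assumes "finite S" "Poly_Mapping.keys f \<subseteq> S"
  shows "subst_mpoly g f = (\<Sum>t\<in>S.
     Polynomial.smult (Poly_Mapping.lookup f t) (\<Prod>i\<in>UNIV. g i ^ Poly_Mapping.lookup t i))"
  unfolding subst_mpoly_def using assms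
  by (intro sum.mono_neutral_left) (auto simp: in_keys_iff)

lemma subst_mpoly_add: "subst_mpoly g (f1 + f2) = subst_mpoly g f1 + subst_mpoly g f2"
proof -
  let ?S = "Poly_Mapping.keys f1 \<union> Poly_Mapping.keys f2"
  have "Poly_Mapping.keys (f1 + f2) \<subseteq> ?S"
    by (rule keys_add)
  then show ?thesis
    by (simp add: subst_mpoly_superset[of ?S] lookup_add smult_add_left sum.distrib)
qed

lemma subst_mpoly_zero [simp]: "subst_mpoly g 0 = 0"
  by (simp add: subst_mpoly_def)

lemma subst_mpoly_sum: "subst_mpoly g (\<Sum>x\<in>A. f x) = (\<Sum>x\<in>A. subst_mpoly g (f x))"
  by (induction A rule: infinite_finite_induct) (simp_all add: subst_mpoly_add)

lemma subst_mpoly_minus: "subst_mpoly g (f1 - f2) = subst_mpoly g f1 - subst_mpoly g f2"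
  using subst_mpoly_add[of g "f1 - f2" f2] by simp

lemma subst_mpoly_single:
  "subst_mpoly g (Poly_Mapping.single t a) = Polynomial.smult a (\<Prod>i\<in>UNIV. g i ^ Poly_Mapping.lookup t i)"
  by (simp add: subst_mpoly_def)

lemma subst_mpoly_mult: "subst_mpoly g (f1 * f2) = subst_mpoly g f1 * subst_mpoly g f2"
proof -
  let ?K1 = "Poly_Mapping.keys f1" and ?K2 = "Poly_Mapping.keys f2"
  let ?m = "\<lambda>f t. Poly_Mapping.single t (Poly_Mapping.lookup f t)"
  have single: "subst_mpoly g (?m f1 s * ?m f2 t) = subst_mpoly g (?m f1 s) * subst_mpoly g (?m f2 t)" for s t
    by (simp add: mult_single subst_mpoly_single lookup_add power_add prod.distrib mult.commute[of "Poly_Mapping.lookup f2 t"])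
  have "subst_mpoly g (f1 * f2) = subst_mpoly g ((\<Sum>s\<in>?K1. ?m f1 s) * (\<Sum>t\<in>?K2. ?m f2 t))"
    by (simp add: sum_single_lookup)
  also have "\<dots> = subst_mpoly g (\<Sum>s\<in>?K1. ?m f1 s) * subst_mpoly g (\<Sum>t\<in>?K2. ?m f2 t)"
    unfolding sum_product subst_mpoly_sum single ..
  finally show ?thesis
    by (simp add: sum_single_lookup)
qed

lemma mvar_power: "mvar i ^ d = (Poly_Mapping.single (Poly_Mapping.single i d) 1 :: ('v, 'k::comm_ring_1) mpoly)"
  by (induction d) (simp_all add: mvar_def mult_single flip: single_add)

lemma mon_degree_add: "mon_degree (s + t) = mon_degree s + mon_degree t"
  by (simp add: mon_degree_def lookup_add sum.distrib)

lemma mon_degree_single [simp]: "mon_degree (Poly_Mapping.single i n) = n"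
  by (simp add: mon_degree_def lookup_single when_def)

lemma homogeneous_zero [simp]: "0 \<in> homogeneous_part m"
  by (simp add: homogeneous_part_def)

lemma homogeneous_single: "mon_degree t = m \<Longrightarrow> Poly_Mapping.single t a \<in> homogeneous_part m"
  by (simp add: homogeneous_part_def)

lemma homogeneous_add:
  "f \<in> homogeneous_part m \<Longrightarrow> g \<in> homogeneous_part m \<Longrightarrow> f + g \<in> homogeneous_part m"
  using keys_add[of f g] by (auto simp: homogeneous_part_def)

lemma homogeneous_minus:
  "f \<in> homogeneous_part m \<Longrightarrow> g \<in> homogeneous_part m \<Longrightarrow> f - g \<in> homogeneous_part m"
  using keys_diff[of f g] by (auto simp: homogeneous_part_def)

lemma homogeneous_sum:
  "(\<And>x. x \<in> A \<Longrightarrow> f x \<in> homogeneous_part m) \<Longrightarrow> (\<Sum>x\<in>A. f x) \<in> homogeneous_part m"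
  by (induction A rule: infinite_finite_induct) (simp_all add: homogeneous_add)

lemma homogeneous_mult:
  "f \<in> homogeneous_part m \<Longrightarrow> g \<in> homogeneous_part n \<Longrightarrow> f * g \<in> homogeneous_part (m + n)"
  using keys_mult[of f g] by (fastforce simp: homogeneous_part_def mon_degree_add)

lemma mvar_homogeneous: "mvar i \<in> homogeneous_part 1"
  by (simp add: mvar_def homogeneous_single)

lemma mvar_power_homogeneous: "mvar i ^ d \<in> homogeneous_part d"
  by (simp add: mvar_power homogeneous_single)

lemma linear_form_homogeneous: "linear_form c \<in> homogeneous_part 1"
  unfolding linear_form_def mconst_def mvar_def mult_single
  by (intro homogeneous_sum homogeneous_single) simp

lemma mon_split:
  fixes t :: "'v \<Rightarrow>\<^sub>0 nat"
  assumes "d \<le> Poly_Mapping.lookup t i"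
  obtains s where "t = Poly_Mapping.single i d + s"
proof
  show "t = Poly_Mapping.single i d + (t - Poly_Mapping.single i d)"
    using assms by (intro poly_mapping_eqI) (auto simp: lookup_add lookup_minus lookup_single when_def)
qed


lemma lookup_mvar_power_mult:
  "Poly_Mapping.lookup (mvar i ^ d * f) (Poly_Mapping.single i d + t) = Poly_Mapping.lookup f t"
proof -
  have "mvar i ^ d * f = (\<Sum>s\<in>Poly_Mapping.keys f.
      Poly_Mapping.single (Poly_Mapping.single i d + s) (Poly_Mapping.lookup f s))"
    by (subst sum_single_lookup[of f, symmetric]) (simp add: mvar_power sum_distrib_left mult_single)
  then have "Poly_Mapping.lookup (mvar i ^ d * f) (Poly_Mapping.single i d + t) =
      (\<Sum>s\<in>Poly_Mapping.keys f. if s = t then Poly_Mapping.lookup f s else 0)"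
    by (simp add: lookup_sum lookup_single when_def)
  then show ?thesis
    by (simp add: in_keys_iff)
qed

lemma lookup_mvar_power_mult_eq_0:
  assumes "Poly_Mapping.lookup t i < d"
  shows "Poly_Mapping.lookup (mvar i ^ d * f) t = 0"
proof (rule ccontr)
  assume "Poly_Mapping.lookup (mvar i ^ d * f) t \<noteq> 0"
  then have "t \<in> Poly_Mapping.keys (mvar i ^ d * f)"
    by (simp add: in_keys_iff)
  then obtain s where "t = Poly_Mapping.single i d + s"
    using keys_mult[of "mvar i ^ d" f] by (auto simp: mvar_power split: if_splits)
  with assms show False
    by (simp add: lookup_add)
qed

lemma lookup_le_mon_degree: "Poly_Mapping.lookup t i \<le> mon_degree t"
  unfolding mon_degree_def by (rule member_le_sum) auto

text \<open>
  In degrees below \<open>2d\<close> the multiples of different \<open>d\<close>-th powers of variables share no monomial.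
\<close>

lemma pure_power_combination_unique:
  fixes \<alpha> :: "'v::finite \<Rightarrow> ('v, 'k::field) mpoly"
  assumes "(\<Sum>i\<in>UNIV. mvar i ^ d * \<alpha> i) = 0" "e < d" "\<And>i. \<alpha> i \<in> homogeneous_part e"
  shows "\<alpha> i = 0"
proof (rule poly_mapping_eqI)
  fix t
  show "Poly_Mapping.lookup (\<alpha> i) t = Poly_Mapping.lookup 0 t"
  proof (cases "t \<in> Poly_Mapping.keys (\<alpha> i)")
    case True
    then have "mon_degree t = e"
      using assms(3) by (auto simp: homogeneous_part_def)
    then have lt: "Poly_Mapping.lookup t j < d" for j
      using lookup_le_mon_degree[of t j] assms(2) by simp
    let ?s = "Poly_Mapping.single i d + t"
    have "0 = (\<Sum>j\<in>UNIV. Poly_Mapping.lookup (mvar j ^ d * \<alpha> j) ?s)"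
      unfolding lookup_sum[symmetric] assms(1) by simp
    also have "\<dots> = (\<Sum>j\<in>UNIV. if j = i then Poly_Mapping.lookup (\<alpha> i) t else 0)"
    proof (intro sum.cong refl)
      fix j
      show "Poly_Mapping.lookup (mvar j ^ d * \<alpha> j) ?s = (if j = i then Poly_Mapping.lookup (\<alpha> i) t else 0)"
        using lt[of j]
        by (auto simp: lookup_mvar_power_mult lookup_add lookup_single intro!: lookup_mvar_power_mult_eq_0)
    qed
    finally show ?thesis
      by simp
  qed (simp add: in_keys_iff)
qed

text \<open>
  The ideal generated by the \<open>d\<close>-th powers of the variables, as the span of its monomials.
\<close>

definition pure_power_ideal :: "nat \<Rightarrow> ('v::finite, 'k::field) mpoly set" where
  "pure_power_ideal d = {f. \<forall>t\<in>Poly_Mapping.keys f. \<exists>i. d \<le> Poly_Mapping.lookup t i}"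

lemma pure_power_ideal_zero [simp]: "0 \<in> pure_power_ideal d"
  by (simp add: pure_power_ideal_def)

lemma pure_power_ideal_add:
  "f \<in> pure_power_ideal d \<Longrightarrow> g \<in> pure_power_ideal d \<Longrightarrow> f + g \<in> pure_power_ideal d"
  using keys_add[of f g] by (auto simp: pure_power_ideal_def)

lemma pure_power_ideal_minus:
  "f \<in> pure_power_ideal d \<Longrightarrow> g \<in> pure_power_ideal d \<Longrightarrow> f - g \<in> pure_power_ideal d"
  using keys_diff[of f g] by (auto simp: pure_power_ideal_def)

lemma pure_power_ideal_sum:
  "(\<And>x. x \<in> A \<Longrightarrow> f x \<in> pure_power_ideal d) \<Longrightarrow> (\<Sum>x\<in>A. f x) \<in> pure_power_ideal d"
  by (induction A rule: infinite_finite_induct) (simp_all add: pure_power_ideal_add)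

lemma pure_power_ideal_mult:
  assumes "f \<in> pure_power_ideal d"
  shows "g * f \<in> pure_power_ideal d"
  unfolding pure_power_ideal_def
proof (intro CollectI ballI)
  fix t assume "t \<in> Poly_Mapping.keys (g * f)"
  then obtain r s where "t = r + s" "s \<in> Poly_Mapping.keys f"
    using keys_mult[of g f] by auto
  then show "\<exists>i. d \<le> Poly_Mapping.lookup t i"
    using assms by (auto simp: pure_power_ideal_def lookup_add intro: trans_le_add2)
qed

lemma mvar_power_in_pure_power_ideal: "mvar i ^ d \<in> pure_power_ideal d"
  by (auto simp: pure_power_ideal_def mvar_power intro: exI[of _ i])

text \<open>
  The multipliers of a form can be chosen homogeneous, because the representation is found monomial by
  monomial. In degrees below \<open>d\<close>, where the subtraction \<open>m - d\<close> is truncated, they vanish.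
\<close>

lemma pure_power_idealE:
  assumes "f \<in> pure_power_ideal d"
  obtains \<alpha> where "f = (\<Sum>i\<in>UNIV. mvar i ^ d * \<alpha> i)"
    "\<And>i m. f \<in> homogeneous_part m \<Longrightarrow> \<alpha> i \<in> homogeneous_part (m - d)"
    "\<And>i m. f \<in> homogeneous_part m \<Longrightarrow> m < d \<Longrightarrow> \<alpha> i = 0"
proof -
  have "\<forall>t\<in>Poly_Mapping.keys f. \<exists>i s. t = Poly_Mapping.single i d + s"
    using assms unfolding pure_power_ideal_def by (blast elim: mon_split)
  then obtain \<iota> \<sigma> where t: "\<And>t. t \<in> Poly_Mapping.keys f \<Longrightarrow> t = Poly_Mapping.single (\<iota> t) d + \<sigma> t"
    by metis
  define \<alpha> where "\<alpha> = (\<lambda>i. \<Sum>t\<in>{t \<in> Poly_Mapping.keys f. \<iota> t = i}.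
    Poly_Mapping.single (\<sigma> t) (Poly_Mapping.lookup f t))"
  have "(\<Sum>i\<in>UNIV. mvar i ^ d * \<alpha> i) =
      (\<Sum>i\<in>UNIV. \<Sum>t\<in>{t \<in> Poly_Mapping.keys f. \<iota> t = i}. Poly_Mapping.single t (Poly_Mapping.lookup f t))"
    unfolding \<alpha>_def sum_distrib_left mvar_power mult_single
    by (intro sum.cong refl) (use t in auto)
  also have "\<dots> = f"
    by (subst sum.group) (simp_all add: sum_single_lookup)
  finally have "f = (\<Sum>i\<in>UNIV. mvar i ^ d * \<alpha> i)" ..
  moreover have deg: "mon_degree (\<sigma> t) + d = m" if "f \<in> homogeneous_part m" "t \<in> Poly_Mapping.keys f" for m t
    using that t[of t] mon_degree_add[of "Poly_Mapping.single (\<iota> t) d" "\<sigma> t"]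
    by (auto simp: homogeneous_part_def)
  moreover have "\<alpha> i \<in> homogeneous_part (m - d)" if "f \<in> homogeneous_part m" for i m
    unfolding \<alpha>_def using deg[OF that] by (intro homogeneous_sum homogeneous_single) force
  moreover have "\<alpha> i = 0" if "f \<in> homogeneous_part m" "m < d" for i m
  proof -
    have "Poly_Mapping.keys f = {}"
      using deg[OF that(1)] that(2) by fastforce
    then show ?thesis
      by (simp add: \<alpha>_def)
  qed
  ultimately show ?thesis
    using that by blast
qed

lemma pure_power_idealI: "(\<Sum>i\<in>UNIV. mvar i ^ d * \<alpha> i) \<in> pure_power_ideal d"
  by (intro pure_power_ideal_sum, subst mult.commute)
    (intro pure_power_ideal_mult mvar_power_in_pure_power_ideal)

section \<open>Multiplication maps on the quotient ring\<close>

lemma mpoly_ring_simps: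
  "carrier mpoly_ring = UNIV" "x \<otimes>\<^bsub>mpoly_ring\<^esub> y = x * y" "x \<oplus>\<^bsub>mpoly_ring\<^esub> y = x + y"
  "\<zero>\<^bsub>mpoly_ring\<^esub> = 0" "\<one>\<^bsub>mpoly_ring\<^esub> = 1"
  by (simp_all add: ring_of_type_algebra_def)

lemma cring_mpoly_ring: "cring (mpoly_ring :: ('v, 'k::comm_ring_1) mpoly ring)"
  by (rule cring_from_type_algebra)

lemma mpoly_ring_a_inv: "\<ominus>\<^bsub>mpoly_ring\<^esub> (x :: ('v, 'k::comm_ring_1) mpoly) = - x"
proof -
  interpret cring "mpoly_ring :: ('v, 'k) mpoly ring"
    by (rule cring_mpoly_ring)
  show ?thesis
    by (rule minus_equality) (simp_all add: mpoly_ring_simps)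
qed

lemma ideal_pure_power_ideal: "ideal (pure_power_ideal d :: ('v::finite, 'k::field) mpoly set) mpoly_ring"
proof -
  interpret cring "mpoly_ring :: ('v, 'k) mpoly ring"
    by (rule cring_mpoly_ring)
  show ?thesis
  proof (rule idealI)
    show "subgroup (pure_power_ideal d) (add_monoid (mpoly_ring :: ('v, 'k) mpoly ring))"
    proof (rule add.subgroupI)
      fix f :: "('v, 'k) mpoly" assume "f \<in> pure_power_ideal d"
      then show "\<ominus>\<^bsub>mpoly_ring\<^esub> f \<in> pure_power_ideal d"
        using pure_power_ideal_minus[of 0 d f] by (simp add: mpoly_ring_a_inv)
    qed (auto simp: mpoly_ring_simps pure_power_ideal_add intro: pure_power_ideal_zero)
    fix a x :: "('v, 'k) mpoly" assume "a \<in> pure_power_ideal d"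
    then show "x \<otimes>\<^bsub>mpoly_ring\<^esub> a \<in> pure_power_ideal d" "a \<otimes>\<^bsub>mpoly_ring\<^esub> x \<in> pure_power_ideal d"
      using pure_power_ideal_mult[of a d x] by (simp_all add: mpoly_ring_simps mult.commute)
  qed (rule ring_axioms)
qed

lemma monomial_ci_ideal_eq: "(monomial_ci_ideal d :: (3, 'k::field) mpoly set) = pure_power_ideal d"
proof -
  interpret cring "mpoly_ring :: (3, 'k) mpoly ring"
    by (rule cring_mpoly_ring)
  let ?G = "{mvar 1 ^ d, mvar 2 ^ d, mvar 3 ^ d} :: (3, 'k) mpoly set"
  have "ideal (Idl\<^bsub>mpoly_ring\<^esub> ?G) mpoly_ring"
    by (rule genideal_ideal) (simp add: mpoly_ring_simps)
  then interpret G: ideal "Idl\<^bsub>mpoly_ring\<^esub> ?G" mpoly_ring .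
  have gen: "mvar i ^ d \<in> Idl\<^bsub>mpoly_ring\<^esub> ?G" for i
  proof -
    have "?G \<subseteq> Idl\<^bsub>mpoly_ring\<^esub> ?G"
      by (rule genideal_self) (simp add: mpoly_ring_simps)
    moreover have "\<forall>i. mvar i ^ d \<in> ?G"
      by (simp add: all_three)
    ultimately show ?thesis
      by blast
  qed
  show ?thesis
  proof
    show "monomial_ci_ideal d \<subseteq> (pure_power_ideal d :: (3, 'k) mpoly set)"
      unfolding monomial_ci_ideal_def
      by (rule genideal_minimal[OF ideal_pure_power_ideal]) (auto intro: mvar_power_in_pure_power_ideal)
    show "pure_power_ideal d \<subseteq> (monomial_ci_ideal d :: (3, 'k) mpoly set)"
    proof
      fix f :: "(3, 'k) mpoly" assume "f \<in> pure_power_ideal d"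
      then obtain \<alpha> where f: "f = (\<Sum>i\<in>UNIV. mvar i ^ d * \<alpha> i)"
        by (rule pure_power_idealE)
      have "mvar i ^ d * \<alpha> i \<in> Idl\<^bsub>mpoly_ring\<^esub> ?G" for i
        using G.I_r_closed[OF gen[of i], of "\<alpha> i"] by (simp add: mpoly_ring_simps)
      then show "f \<in> monomial_ci_ideal d"
        using G.a_closed unfolding f sum_three monomial_ci_ideal_def by (simp add: mpoly_ring_simps)
    qed
  qed
qed

lemma quotient_class_eq_iff:
  fixes I :: "('v::finite, 'k::field) mpoly set"
  assumes "ideal I mpoly_ring"
  shows "I +>\<^bsub>mpoly_ring\<^esub> f = I +>\<^bsub>mpoly_ring\<^esub> g \<longleftrightarrow> f - g \<in> I"
proof -
  interpret cring "mpoly_ring :: ('v, 'k) mpoly ring"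
    by (rule cring_mpoly_ring)
  show ?thesis
    using quotient_eq_iff_same_a_r_cos[OF assms, of f g]
    by (simp add: mpoly_ring_simps a_minus_def mpoly_ring_a_inv)
qed

lemma quotient_zero_eq:
  fixes I :: "('v::finite, 'k::field) mpoly set"
  assumes "ideal I mpoly_ring"
  shows "\<zero>\<^bsub>mpoly_ring Quot I\<^esub> = I +>\<^bsub>mpoly_ring\<^esub> 0"
  by (simp add: FactRing_def a_r_coset_def' mpoly_ring_simps)

lemma quotient_mult:
  fixes I :: "('v::finite, 'k::field) mpoly set"
  assumes "ideal I mpoly_ring"
  shows "(I +>\<^bsub>mpoly_ring\<^esub> f) \<otimes>\<^bsub>mpoly_ring Quot I\<^esub> (I +>\<^bsub>mpoly_ring\<^esub> g) = I +>\<^bsub>mpoly_ring\<^esub> (f * g)"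
  using ideal.rcoset_mult_add[OF assms, of f g] by (simp add: FactRing_def mpoly_ring_simps)

lemma quot_component_trivial_iff:
  fixes I :: "('v::finite, 'k::field) mpoly set"
  assumes "ideal I mpoly_ring"
  shows "quot_component I m = {\<zero>\<^bsub>mpoly_ring Quot I\<^esub>} \<longleftrightarrow> homogeneous_part m \<subseteq> I"
proof -
  have "c ` homogeneous_part m = {c 0} \<longleftrightarrow> (\<forall>f\<in>homogeneous_part m. c f = c 0)"
    for c :: "('v, 'k) mpoly \<Rightarrow> ('v, 'k) mpoly set"
    using homogeneous_zero[of m] by blast
  then show ?thesis
    by (simp add: quot_component_def quotient_zero_eq[OF assms] quotient_class_eq_iff[OF assms] subset_eq)
qed

text \<open>
  Representatives take the place of cosets, here and in the next definition; \<open>maximal_rank_mult_iff\<close> makes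
  the connection.
\<close>

definition injective_mod :: "('v::finite, 'k::field) mpoly set \<Rightarrow> ('v, 'k) mpoly \<Rightarrow> nat \<Rightarrow> bool" where
  "injective_mod I l m \<longleftrightarrow> (\<forall>f\<in>homogeneous_part m. l * f \<in> I \<longrightarrow> f \<in> I)"

definition surjective_mod :: "('v::finite, 'k::field) mpoly set \<Rightarrow> ('v, 'k) mpoly \<Rightarrow> nat \<Rightarrow> bool" where
  "surjective_mod I l m \<longleftrightarrow> (\<forall>g\<in>homogeneous_part (Suc m). \<exists>f\<in>homogeneous_part m. g - l * f \<in> I)"

lemma maximal_rank_mult_iff:
  fixes I :: "('v::finite, 'k::field) mpoly set"
  assumes "ideal I mpoly_ring" "l \<in> homogeneous_part 1"
  shows "maximal_rank_mult I l m \<longleftrightarrow> injective_mod I l m \<or> surjective_mod I l m"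
proof -
  let ?c = "\<lambda>f. I +>\<^bsub>mpoly_ring\<^esub> f"
  define \<mu> where "\<mu> = (\<lambda>a. ?c l \<otimes>\<^bsub>mpoly_ring Quot I\<^esub> a)"
  have \<mu>: "\<mu> (?c f) = ?c (l * f)" for f
    by (simp add: \<mu>_def quotient_mult[OF assms(1)])
  have "inj_on \<mu> (quot_component I m) \<longleftrightarrow>
      (\<forall>f\<in>homogeneous_part m. \<forall>g\<in>homogeneous_part m. l * f - l * g \<in> I \<longrightarrow> f - g \<in> I)"
    by (auto simp: inj_on_def quot_component_def \<mu> quotient_class_eq_iff[OF assms(1)])
  also have "\<dots> \<longleftrightarrow> injective_mod I l m"
  proof
    assume *: "\<forall>f\<in>homogeneous_part m. \<forall>g\<in>homogeneous_part m. l * f - l * g \<in> I \<longrightarrow> f - g \<in> I"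
    show "injective_mod I l m"
      unfolding injective_mod_def
    proof (intro ballI impI)
      fix f assume "f \<in> homogeneous_part m" "l * f \<in> I"
      then show "f \<in> I"
        using *[rule_format, of f 0] by simp
    qed
  next
    assume "injective_mod I l m"
    then show "\<forall>f\<in>homogeneous_part m. \<forall>g\<in>homogeneous_part m. l * f - l * g \<in> I \<longrightarrow> f - g \<in> I"
      by (auto simp: injective_mod_def right_diff_distrib[symmetric] homogeneous_minus)
  qed
  finally have inj: "inj_on \<mu> (quot_component I m) \<longleftrightarrow> injective_mod I l m" .
  have "\<mu> ` quot_component I m \<subseteq> quot_component I (Suc m)"
    using homogeneous_mult[OF assms(2)] by (auto simp: quot_component_def \<mu>)
  then have "\<mu> ` quot_component I m = quot_component I (Suc m) \<longleftrightarrow>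
      (\<forall>a\<in>quot_component I (Suc m). \<exists>b\<in>quot_component I m. a = \<mu> b)"
    by blast
  also have "\<dots> \<longleftrightarrow> surjective_mod I l m"
    by (simp add: surjective_mod_def quot_component_def \<mu> quotient_class_eq_iff[OF assms(1)])
  finally show ?thesis
    unfolding maximal_rank_mult_def Let_def \<mu>_def[symmetric] inj by simp
qed

text \<open>
  The quotient is generated in degree one: every monomial of degree \<open>m + 2\<close> is a variable times a monomial of
  degree \<open>m + 1\<close>, which is a multiple of \<open>l\<close> modulo the ideal.
\<close>

lemma surjective_mod_Suc:
  fixes l :: "('v::finite, 'k::field) mpoly"
  assumes "surjective_mod (pure_power_ideal d) l m"
  shows "surjective_mod (pure_power_ideal d) l (Suc m)"
proof -
  define P where "P = (\<lambda>g :: ('v, 'k) mpoly. \<exists>f\<in>homogeneous_part (Suc m). g - l * f \<in> pure_power_ideal d)"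
  have zero: "P 0"
    unfolding P_def by (intro bexI[of _ 0]) auto
  have add: "P (g1 + g2)" if "P g1" "P g2" for g1 g2
  proof -
    from that obtain f1 f2 where f: "f1 \<in> homogeneous_part (Suc m)" "g1 - l * f1 \<in> pure_power_ideal d"
        "f2 \<in> homogeneous_part (Suc m)" "g2 - l * f2 \<in> pure_power_ideal d"
      unfolding P_def by blast
    have "(g1 + g2) - l * (f1 + f2) = (g1 - l * f1) + (g2 - l * f2)"
      by (simp add: algebra_simps)
    then have "(g1 + g2) - l * (f1 + f2) \<in> pure_power_ideal d"
      using f by (simp only: pure_power_ideal_add)
    with f show ?thesis
      unfolding P_def by (intro bexI[of _ "f1 + f2"] homogeneous_add)
  qed
  have single: "P (Poly_Mapping.single t a)" if t: "mon_degree t = Suc (Suc m)" for t a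
  proof -
    have "\<exists>i. 1 \<le> Poly_Mapping.lookup t i"
    proof (rule ccontr)
      assume "\<not> ?thesis"
      then have "mon_degree t = 0"
        by (simp add: mon_degree_def not_le)
      with t show False
        by simp
    qed
    then obtain i s where s: "t = Poly_Mapping.single i 1 + s"
      by (meson mon_split)
    then have "Poly_Mapping.single s a \<in> homogeneous_part (Suc m)"
      using t by (intro homogeneous_single) (simp add: mon_degree_add)
    then obtain f where f: "f \<in> homogeneous_part m" "Poly_Mapping.single s a - l * f \<in> pure_power_ideal d"
      using assms by (auto simp: surjective_mod_def)
    have "Poly_Mapping.single t a - l * (mvar i * f) = mvar i * (Poly_Mapping.single s a - l * f)"
      by (simp add: s mvar_def mult_single right_diff_distrib mult.left_commute)
    then have "Poly_Mapping.single t a - l * (mvar i * f) \<in> pure_power_ideal d"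
      using pure_power_ideal_mult[OF f(2)] by simp
    moreover have "mvar i * f \<in> homogeneous_part (Suc m)"
      using homogeneous_mult[OF mvar_homogeneous f(1)] by simp
    ultimately show ?thesis
      unfolding P_def by blast
  qed
  have "P g" if "g \<in> homogeneous_part (Suc (Suc m))" for g
  proof -
    have "P (\<Sum>t\<in>A. Poly_Mapping.single t (Poly_Mapping.lookup g t))" if "A \<subseteq> Poly_Mapping.keys g" for A
      using that \<open>g \<in> _\<close>
      by (induction A rule: infinite_finite_induct)
        (auto simp: homogeneous_part_def zero intro!: add single)
    from this[of "Poly_Mapping.keys g"] show ?thesis
      by (simp add: sum_single_lookup)
  qed
  then show ?thesis
    by (simp add: surjective_mod_def P_def)
qed

lemma surjective_mod_mono:
  fixes l :: "('v::finite, 'k::field) mpoly"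
  assumes "surjective_mod (pure_power_ideal d) l m" "m \<le> n"
  shows "surjective_mod (pure_power_ideal d) l n"
  using assms(2,1) by (induction n rule: dec_induct) (auto intro: surjective_mod_Suc)

section \<open>Restriction to a line\<close>

text \<open>
  The line where the form \<open>c\<^sub>1X + c\<^sub>2Y + c\<^sub>3Z\<close> vanishes, in the affine chart \<open>Y = 1 / c\<^sub>2\<close>. This parametrization
  makes the restrictions of \<open>X\<^sup>d\<close>, \<open>Y\<^sup>d\<close>, \<open>Z\<^sup>d\<close> scalar multiples of \<open>x\<^sup>d\<close>, \<open>1\<close>, \<open>(1 + x)\<^sup>d\<close>,
  whatever the nonzero coefficients of the linear form are.
\<close>

definition line_point :: "(3 \<Rightarrow> 'k::field) \<Rightarrow> 3 \<Rightarrow> 'k poly" where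
  "line_point c i =
     (if i = 1 then [:0, 1 / c 1:] else if i = 2 then [:1 / c 2:] else Polynomial.smult (- 1 / c 3) [:1, 1:])"

definition restrict_line :: "(3 \<Rightarrow> 'k::field) \<Rightarrow> (3, 'k) mpoly \<Rightarrow> 'k poly" where
  "restrict_line c = subst_mpoly (line_point c)"

text \<open>
  The form of degree \<open>e\<close> in \<open>X\<close> and \<open>Y\<close> with a prescribed restriction to the line.
\<close>

definition binary_form :: "(3 \<Rightarrow> 'k::field) \<Rightarrow> nat \<Rightarrow> 'k poly \<Rightarrow> (3, 'k) mpoly" where
  "binary_form c e C = (\<Sum>i\<le>e. Poly_Mapping.single
     (Poly_Mapping.single 1 i + Poly_Mapping.single 2 (e - i)) (Polynomial.coeff C i * c 1 ^ i * c 2 ^ (e - i)))"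

lemma single_one_eq_iff:
  "Poly_Mapping.single i (Suc 0) = Poly_Mapping.single j (Suc 0) \<longleftrightarrow> i = j"
  by (metis keys_single nat.distinct(1) singleton_inject)

lemma line_point_power:
  "line_point c 1 ^ d = Polynomial.smult (1 / c 1 ^ d) (Polynomial.monom 1 d)"
  "line_point c 2 ^ d = [:1 / c 2 ^ d:]"
  "line_point c 3 ^ d = Polynomial.smult ((- 1 / c 3) ^ d) ([:1, 1:] ^ d)"
proof -
  have "line_point c 1 = Polynomial.monom (1 / c 1) 1"
    by (simp add: line_point_def monom_altdef)
  then show "line_point c 1 ^ d = Polynomial.smult (1 / c 1 ^ d) (Polynomial.monom 1 d)"
    by (simp add: monom_power power_divide smult_monom)
  show "line_point c 2 ^ d = [:1 / c 2 ^ d:]"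
    by (simp add: line_point_def poly_const_pow power_divide)
  have "line_point c 3 = Polynomial.smult (- 1 / c 3) [:1, 1:]"
    by (simp add: line_point_def)
  then show "line_point c 3 ^ d = Polynomial.smult ((- 1 / c 3) ^ d) ([:1, 1:] ^ d)"
    by (simp only: smult_power)
qed

lemma binary_form_homogeneous: "binary_form c e C \<in> homogeneous_part e"
  unfolding binary_form_def by (intro homogeneous_sum homogeneous_single) (simp add: mon_degree_add)

lemma binary_form_zero [simp]: "binary_form c e 0 = 0"
  by (simp add: binary_form_def)

lemma binary_form_add: "binary_form c e (C + D) = binary_form c e C + binary_form c e D"
  by (simp add: binary_form_def algebra_simps single_add sum.distrib)

lemma degree_line_point: "Polynomial.degree (line_point c i) \<le> 1"
  by (auto simp: line_point_def intro: order_trans[OF degree_smult_le])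

lemma degree_restrict_line:
  assumes "f \<in> homogeneous_part m"
  shows "Polynomial.degree (restrict_line c f) \<le> m"
  unfolding restrict_line_def subst_mpoly_def
proof (intro degree_sum_le order_trans[OF degree_smult_le])
  fix t assume "t \<in> Poly_Mapping.keys f"
  have "Polynomial.degree (\<Prod>i\<in>UNIV. line_point c i ^ Poly_Mapping.lookup t i)
      \<le> (\<Sum>i\<in>UNIV. Polynomial.degree (line_point c i ^ Poly_Mapping.lookup t i))"
    by (intro degree_prod_sum_le[unfolded comp_def]) simp
  also have "\<dots> \<le> (\<Sum>i\<in>UNIV. 1 * Poly_Mapping.lookup t i)"
    by (intro sum_mono order_trans[OF degree_power_le] mult_le_mono1 degree_line_point)
  also have "\<dots> = m"
    using assms \<open>t \<in> Poly_Mapping.keys f\<close> by (simp add: homogeneous_part_def mon_degree_def)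
  finally show "Polynomial.degree (\<Prod>i\<in>UNIV. line_point c i ^ Poly_Mapping.lookup t i) \<le> m" .
qed simp

lemma restrict_line_mvar_power: "restrict_line c (mvar i ^ d) = line_point c i ^ d"
proof -
  have "(\<Prod>j\<in>UNIV. line_point c j ^ Poly_Mapping.lookup (Poly_Mapping.single i d) j) =
      (\<Prod>j\<in>UNIV. if i = j then line_point c j ^ d else 1)"
    by (intro prod.cong) (auto simp: lookup_single)
  then show ?thesis
    by (simp add: restrict_line_def mvar_power subst_mpoly_single)
qed

lemma restrict_line_mult: "restrict_line c (f * g) = restrict_line c f * restrict_line c g"
  and restrict_line_add: "restrict_line c (f + g) = restrict_line c f + restrict_line c g"
  and restrict_line_minus: "restrict_line c (f - g) = restrict_line c f - restrict_line c g"
  and restrict_line_zero [simp]: "restrict_line c 0 = 0"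
  by (simp_all add: restrict_line_def subst_mpoly_mult subst_mpoly_add subst_mpoly_minus)

context
  fixes c :: "3 \<Rightarrow> 'k::field"
  assumes nz: "\<And>i. c i \<noteq> 0"
begin

lemma restrict_line_binary_monomial:
  "restrict_line c (Poly_Mapping.single (Poly_Mapping.single 1 i + Poly_Mapping.single 2 j) a) =
     Polynomial.monom (a / (c 1 ^ i * c 2 ^ j)) i"
  by (simp add: restrict_line_def subst_mpoly_single prod_three lookup_add lookup_single
      line_point_power smult_monom)

lemma restrict_line_binary_form:
  assumes "Polynomial.degree C \<le> e"
  shows "restrict_line c (binary_form c e C) = C"
proof -
  have "restrict_line c (binary_form c e C) = (\<Sum>i\<le>e. Polynomial.monom (Polynomial.coeff C i) i)"
    unfolding binary_form_def restrict_line_def subst_mpoly_sum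
    unfolding restrict_line_def[symmetric] restrict_line_binary_monomial
    using nz by (intro sum.cong) auto
  also have "\<dots> = C"
    using assms by (rule poly_as_sum_of_monoms')
  finally show ?thesis .
qed

lemma restrict_line_linear_form: "restrict_line c (linear_form c) = 0"
proof -
  have "restrict_line c (mconst a * mvar i) = Polynomial.smult a (line_point c i)" for a i
    using restrict_line_mvar_power[of c i 1]
    by (simp add: restrict_line_mult) (simp add: restrict_line_def mconst_def subst_mpoly_single)
  then show ?thesis
    using nz by (simp add: linear_form_def sum_three restrict_line_add line_point_def)
qed

lemma linear_form_nonzero: "linear_form c \<noteq> 0"
proof
  assume "linear_form c = 0"
  then have "Poly_Mapping.lookup (linear_form c) (Poly_Mapping.single 1 1) = 0"
    by simp
  moreover have "Poly_Mapping.lookup (linear_form c) (Poly_Mapping.single 1 1) = c 1"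
    by (simp add: linear_form_def sum_three mconst_def mvar_def mult_single lookup_add lookup_single
        single_one_eq_iff)
  ultimately show False
    using nz by simp
qed

text \<open>
  Modulo the linear form the third variable can be eliminated. The condition on the cofactor \<open>g\<close> says that it
  is homogeneous of degree \<open>m - 1\<close>, which means \<open>g = 0\<close> for \<open>m = 0\<close>.
\<close>

definition reducible_to_binary :: "nat \<Rightarrow> (3, 'k) mpoly \<Rightarrow> bool" where
  "reducible_to_binary m f \<longleftrightarrow> (\<exists>g C. f = linear_form c * g + binary_form c m C \<and>
     Polynomial.degree C \<le> m \<and> (\<forall>j. m = Suc j \<longrightarrow> g \<in> homogeneous_part j) \<and> (m = 0 \<longrightarrow> g = 0))"

lemma reducible_to_binary_add:
  assumes "reducible_to_binary m f1" "reducible_to_binary m f2"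
  shows "reducible_to_binary m (f1 + f2)"
proof -
  obtain g1 C1 where 1: "f1 = linear_form c * g1 + binary_form c m C1"
      "Polynomial.degree C1 \<le> m" "\<forall>j. m = Suc j \<longrightarrow> g1 \<in> homogeneous_part j" "m = 0 \<longrightarrow> g1 = 0"
    using assms(1) by (auto simp: reducible_to_binary_def)
  obtain g2 C2 where 2: "f2 = linear_form c * g2 + binary_form c m C2"
      "Polynomial.degree C2 \<le> m" "\<forall>j. m = Suc j \<longrightarrow> g2 \<in> homogeneous_part j" "m = 0 \<longrightarrow> g2 = 0"
    using assms(2) by (auto simp: reducible_to_binary_def)
  show ?thesis
    unfolding reducible_to_binary_def using 1 2
    by (intro exI[of _ "g1 + g2"] exI[of _ "C1 + C2"])
      (auto simp: binary_form_add algebra_simps intro: degree_add_le homogeneous_add)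
qed

text \<open>
  Replace one factor \<open>Z\<close> by \<open>(l - c\<^sub>1X - c\<^sub>2Y) / c\<^sub>3\<close> and proceed by induction on the exponent of \<open>Z\<close>.
\<close>

lemma reducible_to_binary_single:
  "mon_degree t = m \<Longrightarrow> reducible_to_binary m (Poly_Mapping.single t a)"
proof (induction "Poly_Mapping.lookup t 3" arbitrary: t a)
  case 0
  define i where "i = Poly_Mapping.lookup t 1"
  have "m = i + Poly_Mapping.lookup t 2"
    using 0 by (simp add: mon_degree_def sum_three i_def)
  then have t: "t = Poly_Mapping.single 1 i + Poly_Mapping.single 2 (m - i)" and "i \<le> m"
    using 0 unfolding i_def
    by (auto simp: poly_mapping_eq_iff fun_eq_iff all_three lookup_add lookup_single)
  define C where "C = Polynomial.monom (a / (c 1 ^ i * c 2 ^ (m - i))) i"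
  have "binary_form c m C = (\<Sum>j\<le>m. if j = i then Poly_Mapping.single t a else 0)"
    unfolding binary_form_def C_def using nz by (intro sum.cong) (auto simp: t)
  then have "binary_form c m C = Poly_Mapping.single t a"
    using \<open>i \<le> m\<close> by simp
  moreover have "Polynomial.degree C \<le> m"
    unfolding C_def using \<open>i \<le> m\<close> degree_monom_le order_trans by blast
  ultimately show ?case
    unfolding reducible_to_binary_def by (intro exI[of _ 0] exI[of _ C]) auto
next
  case (Suc n)
  then obtain s where t: "t = Poly_Mapping.single 3 1 + s"
    by (metis mon_split le_add1 plus_1_eq_Suc)
  have n: "Poly_Mapping.lookup s 3 = n"
    using Suc(2) by (simp add: t lookup_add)
  have m: "m = Suc (mon_degree s)"
    using Suc.prems by (simp add: t mon_degree_add)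
  let ?b = "a / c 3"
  let ?s = "Poly_Mapping.single s ?b"
  have "linear_form c * ?s =
      Poly_Mapping.single (Poly_Mapping.single 1 1 + s) (c 1 * ?b) +
      Poly_Mapping.single (Poly_Mapping.single 2 1 + s) (c 2 * ?b) + Poly_Mapping.single t a"
    using nz by (simp add: linear_form_def sum_three mconst_def mvar_def mult_single t distrib_right)
  then have "Poly_Mapping.single t a = linear_form c * ?s +
      (Poly_Mapping.single (Poly_Mapping.single 1 1 + s) (- c 1 * ?b) +
       Poly_Mapping.single (Poly_Mapping.single 2 1 + s) (- c 2 * ?b))"
    by (simp add: single_uminus)
  moreover have "reducible_to_binary m (linear_form c * ?s)"
    unfolding reducible_to_binary_def
    by (intro exI[of _ ?s] exI[of _ 0]) (auto simp: m homogeneous_single)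
  moreover have "reducible_to_binary m (Poly_Mapping.single (Poly_Mapping.single i 1 + s) x)"
    if "i \<noteq> 3" for i x
    using that n m by (intro Suc.hyps(1)) (simp_all add: lookup_add lookup_single mon_degree_add)
  ultimately show ?case
    by (simp add: reducible_to_binary_add)
qed

lemma reducible_to_binary_homogeneous:
  assumes "f \<in> homogeneous_part m"
  shows "reducible_to_binary m f"
proof -
  have "reducible_to_binary m 0"
    unfolding reducible_to_binary_def by (intro exI[of _ 0]) auto
  then have "reducible_to_binary m (\<Sum>t\<in>A. Poly_Mapping.single t (Poly_Mapping.lookup f t))"
    if "A \<subseteq> Poly_Mapping.keys f" for A
    using that assms
    by (induction A rule: infinite_finite_induct)
      (auto simp: homogeneous_part_def intro!: reducible_to_binary_add reducible_to_binary_single)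
  from this[of "Poly_Mapping.keys f"] show ?thesis
    by (simp add: sum_single_lookup)
qed

text \<open>
  Reduce \<open>f\<close> to a form in \<open>X\<close> and \<open>Y\<close>. That form has the same restriction to the line, and it is
  determined by its restriction.
\<close>

lemma restrict_line_eq_0D:
  assumes "f \<in> homogeneous_part m" "restrict_line c f = 0"
  obtains g where "f = linear_form c * g" "\<And>j. m = Suc j \<Longrightarrow> g \<in> homogeneous_part j"
proof -
  obtain g C where f: "f = linear_form c * g + binary_form c m C" "Polynomial.degree C \<le> m"
      and g: "\<forall>j. m = Suc j \<longrightarrow> g \<in> homogeneous_part j"
    using reducible_to_binary_homogeneous[OF assms(1)] by (auto simp: reducible_to_binary_def)
  have "C = restrict_line c f"
    using f by (simp add: restrict_line_add restrict_line_mult restrict_line_linear_form restrict_line_binary_form)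
  then have "C = 0"
    using assms(2) by simp
  then have "f = linear_form c * g"
    using f(1) by simp
  with g show ?thesis
    using that by blast
qed

lemma restrict_line_combination:
  "restrict_line c (\<Sum>i\<in>UNIV. mvar i ^ d * \<alpha> i) =
     Polynomial.monom 1 d * Polynomial.smult (1 / c 1 ^ d) (restrict_line c (\<alpha> 1)) +
     Polynomial.smult (1 / c 2 ^ d) (restrict_line c (\<alpha> 2)) +
     Polynomial.smult ((- 1 / c 3) ^ d) (restrict_line c (\<alpha> 3)) * [:1, 1:] ^ d"
  by (simp add: sum_three restrict_line_add restrict_line_mult restrict_line_mvar_power line_point_power
      mult.commute)

section \<open>Ranks of the multiplication maps\<close>

text \<open>
  If \<open>l f = \<alpha>\<^sub>1X\<^sup>d + \<alpha>\<^sub>2Y\<^sup>d + \<alpha>\<^sub>3Z\<^sup>d\<close>, restriction to the line gives a relation of degree too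
  small for a nonzero third coefficient, and then all coefficients vanish. Hence each \<open>\<alpha>\<^sub>i\<close> is divisible by
  \<open>l\<close>, and \<open>l\<close> can be cancelled.
\<close>

lemma low_degree_injective:
  assumes "\<And>C. \<not> low_syzygy d (C :: 'k poly)" "m + 2 \<le> d + d div 2"
  shows "injective_mod (pure_power_ideal d) (linear_form c) m"
  unfolding injective_mod_def
proof (intro ballI impI)
  fix f assume f: "f \<in> homogeneous_part m" and lf: "linear_form c * f \<in> pure_power_ideal d"
  have lf_hom: "linear_form c * f \<in> homogeneous_part (Suc m)"
    using homogeneous_mult[OF linear_form_homogeneous f] by simp
  define e where "e = Suc m - d"
  obtain \<alpha> where \<alpha>: "linear_form c * f = (\<Sum>i\<in>UNIV. mvar i ^ d * \<alpha> i)"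
    and hom: "\<And>i. \<alpha> i \<in> homogeneous_part e" and triv: "\<And>i. Suc m < d \<Longrightarrow> \<alpha> i = 0"
    using lf lf_hom unfolding e_def by (elim pure_power_idealE) blast
  show "f \<in> pure_power_ideal d"
  proof (cases "Suc m < d")
    case True
    then have "linear_form c * f = 0"
      using \<alpha> triv by simp
    then show ?thesis
      using linear_form_nonzero by simp
  next
    case False
    have e: "e < d div 2"
      using False assms(2) by (simp add: e_def)
    define A where "A = Polynomial.smult (1 / c 1 ^ d) (restrict_line c (\<alpha> 1))"
    define B where "B = Polynomial.smult (1 / c 2 ^ d) (restrict_line c (\<alpha> 2))"
    define C where "C = Polynomial.smult ((- 1 / c 3) ^ d) (restrict_line c (\<alpha> 3))"
    have deg: "Polynomial.degree A \<le> e" "Polynomial.degree B \<le> e" "Polynomial.degree C \<le> e"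
      unfolding A_def B_def C_def by (intro order_trans[OF degree_smult_le] degree_restrict_line hom)+
    have "restrict_line c (linear_form c * f) = 0"
      by (simp add: restrict_line_mult restrict_line_linear_form)
    then have rel: "Polynomial.monom 1 d * A + B + C * [:1, 1:] ^ d = 0"
      unfolding \<alpha> restrict_line_combination A_def B_def C_def .
    then have C_rel: "C * [:1, 1:] ^ d = - (Polynomial.monom 1 d * A + B)"
      by (metis add.commute eq_neg_iff_add_eq_0)
    have "C = 0"
    proof (rule ccontr)
      assume "C \<noteq> 0"
      then have "low_syzygy d C"
        unfolding low_syzygy_def C_rel using deg e by (auto simp: coeff_monom_mult intro!: coeff_eq_0)
      with assms(1) show False
        by blast
    qed
    with rel have AB: "Polynomial.monom 1 d * A + B = 0"
      by simp
    have "Polynomial.coeff B i = 0" for i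
    proof (cases "i < d")
      case True
      then show ?thesis
        using arg_cong[OF AB, of "\<lambda>p. Polynomial.coeff p i"] by (simp add: coeff_monom_mult)
    next
      case False
      then show ?thesis
        using deg(2) e by (intro coeff_eq_0) simp
    qed
    then have "B = 0"
      by (simp add: poly_eq_iff)
    with AB have "A = 0"
      by simp
    have "restrict_line c (\<alpha> i) = 0" for i
      using \<open>A = 0\<close> \<open>B = 0\<close> \<open>C = 0\<close> nz unfolding A_def B_def C_def
      by (cases "i = 1 \<or> i = 2 \<or> i = 3") (use UNIV_three in auto)
    then have "\<exists>g. \<alpha> i = linear_form c * g" for i
      using restrict_line_eq_0D[OF hom[of i]] by metis
    then obtain \<gamma> where "\<And>i. \<alpha> i = linear_form c * \<gamma> i"
      by metis
    then have "linear_form c * f = linear_form c * (\<Sum>i\<in>UNIV. mvar i ^ d * \<gamma> i)"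
      unfolding \<alpha> by (simp add: sum_distrib_left mult_ac)
    then have "f = (\<Sum>i\<in>UNIV. mvar i ^ d * \<gamma> i)"
      using linear_form_nonzero by simp
    then show ?thesis
      by (simp add: pure_power_idealI)
  qed
qed

text \<open>
  Supplies elements of the ideal with a prescribed restriction to the line; the coefficients are lifted to
  forms in \<open>X\<close> and \<open>Y\<close>.
\<close>

lemma lift_relation:
  assumes "Polynomial.degree A \<le> e" "Polynomial.degree B \<le> e" "Polynomial.degree C \<le> e"
  obtains \<alpha> where "\<And>i. \<alpha> i \<in> homogeneous_part e"
    "restrict_line c (\<Sum>i\<in>UNIV. mvar i ^ d * \<alpha> i) = Polynomial.monom 1 d * A + B + C * [:1, 1:] ^ d"
    "restrict_line c (\<alpha> 3) = Polynomial.smult ((- c 3) ^ d) C"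
proof
  define \<alpha> where "\<alpha> = (\<lambda>i :: 3. binary_form c e
    (if i = 1 then Polynomial.smult (c 1 ^ d) A
     else if i = 2 then Polynomial.smult (c 2 ^ d) B
     else Polynomial.smult ((- c 3) ^ d) C))"
  show "\<alpha> i \<in> homogeneous_part e" for i
    by (simp add: \<alpha>_def binary_form_homogeneous)
  show "restrict_line c (\<Sum>i\<in>UNIV. mvar i ^ d * \<alpha> i) =
      Polynomial.monom 1 d * A + B + C * [:1, 1:] ^ d"
    unfolding restrict_line_combination \<alpha>_def using assms nz
    by (simp add: restrict_line_binary_form flip: power_mult_distrib)
  show "restrict_line c (\<alpha> 3) = Polynomial.smult ((- c 3) ^ d) C"
    using assms(3) nz by (simp add: \<alpha>_def restrict_line_binary_form)
qed

text \<open>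
  By \<open>no_low_syzygy_imp_middle_coeffs\<close> a multiple of \<open>(1 + x)\<^sup>d\<close> cancels the middle coefficients of the
  restriction of \<open>g\<close>; the rest splits into a multiple of \<open>x\<^sup>d\<close> and a polynomial of low degree. So \<open>g\<close>
  agrees on the line with an element \<open>F\<close> of the ideal, and \<open>g - F\<close> is divisible by \<open>l\<close>.
\<close>

lemma high_degree_surjective:
  assumes "\<And>C. \<not> low_syzygy d (C :: 'k poly)" "d \<ge> 1"
  shows "surjective_mod (pure_power_ideal d) (linear_form c) (2 * d - 2 - d div 2)"
  unfolding surjective_mod_def
proof
  define e where "e = d - 1 - d div 2"
  have deg_eq: "Suc (2 * d - 2 - d div 2) = d + e"
    using assms(2) div_less_dividend[of 2 d] unfolding e_def by linarith
  fix g :: "(3, 'k) mpoly" assume "g \<in> homogeneous_part (Suc (2 * d - 2 - d div 2))"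
  then have g: "g \<in> homogeneous_part (d + e)"
    by (simp only: deg_eq)
  define G where "G = restrict_line c g"
  have deg_G: "Polynomial.degree G \<le> d + e"
    unfolding G_def using g by (rule degree_restrict_line)
  obtain C :: "'k poly" where C: "Polynomial.degree C \<le> e"
    "\<And>i. d - d div 2 \<le> i \<Longrightarrow> i < d \<Longrightarrow> Polynomial.coeff (C * [:1, 1:] ^ d) i = Polynomial.coeff G i"
    using no_low_syzygy_imp_middle_coeffs[OF assms(1), of "Polynomial.coeff G"] unfolding e_def by blast
  define R where "R = G - C * [:1, 1:] ^ d"
  have "Polynomial.degree (C * [:1, 1:] ^ d) \<le> e + 1 * d"
    by (intro order_trans[OF degree_mult_le] add_mono C(1) order_trans[OF degree_power_le]) simp
  then have deg_R: "Polynomial.degree R \<le> d + e"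
    unfolding R_def using deg_G by (intro degree_diff_le) simp_all
  have "Polynomial.coeff R i = 0" if "e < i" "i < d" for i
    using that C(2)[of i] by (simp add: R_def e_def)
  then obtain A B where R: "R = Polynomial.monom 1 d * A + B"
      and AB: "Polynomial.degree B \<le> e" "Polynomial.degree A \<le> e"
    using split_at_gap[of e d R] deg_R by metis
  obtain \<alpha> where \<alpha>: "\<And>i. \<alpha> i \<in> homogeneous_part e"
      "restrict_line c (\<Sum>i\<in>UNIV. mvar i ^ d * \<alpha> i) = Polynomial.monom 1 d * A + B + C * [:1, 1:] ^ d"
    by (rule lift_relation[OF AB(2,1) C(1), of d]) blast
  define F where "F = (\<Sum>i\<in>UNIV. mvar i ^ d * \<alpha> i)"
  have F_hom: "F \<in> homogeneous_part (d + e)"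
    unfolding F_def by (intro homogeneous_sum homogeneous_mult mvar_power_homogeneous \<alpha>(1))
  have "restrict_line c (g - F) = 0"
    unfolding restrict_line_minus F_def \<alpha>(2) G_def[symmetric] R[symmetric] by (simp add: R_def)
  then obtain f where f: "g - F = linear_form c * f" "\<And>j. d + e = Suc j \<Longrightarrow> f \<in> homogeneous_part j"
    using restrict_line_eq_0D[OF homogeneous_minus[OF g F_hom]] by metis
  have "g - linear_form c * f = F"
    using f(1) by (simp add: algebra_simps)
  then have "g - linear_form c * f \<in> pure_power_ideal d"
    unfolding F_def by (simp add: pure_power_idealI)
  with f(2)[OF deg_eq[symmetric]]
  show "\<exists>f\<in>homogeneous_part (2 * d - 2 - d div 2). g - linear_form c * f \<in> pure_power_ideal d"
    by blast
qed

text \<open>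
  The relation given by a low syzygy lifts to an element \<open>F = l f\<close> of the ideal. If \<open>f\<close> were in the ideal, comparing
  the multipliers of \<open>Z\<^sup>d\<close> would show that the multiplier in \<open>F\<close> is divisible by \<open>l\<close>, contrary to its
  nonzero restriction.
\<close>

lemma low_syzygy_imp_not_injective:
  assumes C: "low_syzygy d (C :: 'k poly)"
  shows "\<not> injective_mod (pure_power_ideal d) (linear_form c) (d + d div 2 - 2)"
proof
  assume inj: "injective_mod (pure_power_ideal d) (linear_form c) (d + d div 2 - 2)"
  have pos: "d div 2 > 0"
    using C by (rule low_syzygy_pos)
  define m e where "m = d + d div 2 - 2" and "e = d div 2 - 1"
  have m: "Suc m = d + e"
    using pos by (simp add: m_def e_def)
  have "e < d"
    using pos by (simp add: e_def)
  have "C \<noteq> 0" and deg_C: "Polynomial.degree C \<le> e"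
    using C pos by (auto simp: low_syzygy_def e_def intro!: degree_le)
  define R where "R = - (C * [:1, 1:] ^ d)"
  have "Polynomial.degree (C * [:1, 1:] ^ d) \<le> e + 1 * d"
    by (intro order_trans[OF degree_mult_le] add_mono deg_C order_trans[OF degree_power_le]) simp
  then have deg_R: "Polynomial.degree R \<le> d + e"
    by (simp add: R_def)
  have "Polynomial.coeff R i = 0" if "e < i" "i < d" for i
    using that C by (simp add: R_def e_def low_syzygy_def)
  then obtain A B where R: "R = Polynomial.monom 1 d * A + B"
      and AB: "Polynomial.degree B \<le> e" "Polynomial.degree A \<le> e"
    using split_at_gap[of e d R] deg_R by metis
  obtain \<alpha> where \<alpha>_hom: "\<And>i. \<alpha> i \<in> homogeneous_part e"
      and \<alpha>: "restrict_line c (\<Sum>i\<in>UNIV. mvar i ^ d * \<alpha> i) = Polynomial.monom 1 d * A + B + C * [:1, 1:] ^ d"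
      and \<alpha>3: "restrict_line c (\<alpha> 3) = Polynomial.smult ((- c 3) ^ d) C"
    by (rule lift_relation[OF AB(2,1) deg_C, of d]) blast
  define F where "F = (\<Sum>i\<in>UNIV. mvar i ^ d * \<alpha> i)"
  have F_hom: "F \<in> homogeneous_part (d + e)"
    unfolding F_def by (intro homogeneous_sum homogeneous_mult mvar_power_homogeneous \<alpha>_hom)
  have "restrict_line c F = 0"
    unfolding F_def \<alpha> R[symmetric] by (simp add: R_def)
  then obtain f where f: "F = linear_form c * f" "f \<in> homogeneous_part m"
    using restrict_line_eq_0D[OF F_hom] m by metis
  have "linear_form c * f \<in> pure_power_ideal d"
    unfolding f(1)[symmetric] F_def by (rule pure_power_idealI)
  with inj f(2) have "f \<in> pure_power_ideal d"
    by (simp add: injective_mod_def m_def)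
  then obtain \<beta> where \<beta>: "f = (\<Sum>i\<in>UNIV. mvar i ^ d * \<beta> i)"
      "\<And>i. \<beta> i \<in> homogeneous_part (m - d)" "\<And>i. m < d \<Longrightarrow> \<beta> i = 0"
    using f(2) by (elim pure_power_idealE) blast
  have \<beta>_hom: "linear_form c * \<beta> i \<in> homogeneous_part e" for i
  proof (cases "m < d")
    case False
    then have "1 + (m - d) = e"
      using m by simp
    with homogeneous_mult[OF linear_form_homogeneous \<beta>(2)] show ?thesis
      by metis
  qed (simp add: \<beta>(3))
  have "(\<Sum>i\<in>UNIV. mvar i ^ d * (\<alpha> i - linear_form c * \<beta> i)) = 0"
    using f(1) unfolding F_def \<beta>(1) by (simp add: right_diff_distrib sum_subtractf sum_distrib_left mult_ac)
  then have "\<alpha> 3 - linear_form c * \<beta> 3 = 0"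
    using \<open>e < d\<close>
    by (rule pure_power_combination_unique[of d "\<lambda>i. \<alpha> i - linear_form c * \<beta> i" e 3])
      (intro homogeneous_minus \<alpha>_hom \<beta>_hom)
  then have "restrict_line c (\<alpha> 3) = 0"
    by (simp add: restrict_line_mult restrict_line_linear_form)
  then have "C = 0"
    using \<alpha>3 nz by simp
  with \<open>C \<noteq> 0\<close> show False ..
qed

text \<open>
  Consider the functional \<open>P \<mapsto>\<close> coefficient of \<open>x\<^sup>d\<^sup>-\<^sup>1\<close> in \<open>P C\<close>. For multiples of \<open>x\<^sup>d\<close>, for polynomials
  of degree at most \<open>d - 1 - d div 2\<close> and for their multiples by \<open>(1 + x)\<^sup>d\<close> it vanishes, so under surjectivity it vanishes
  on \<open>x\<^sup>i\<close> for all \<open>i < d\<close>. Its value there is the coefficient of \<open>x\<^sup>d\<^sup>-\<^sup>1\<^sup>-\<^sup>i\<close> in \<open>C\<close>.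
\<close>

lemma low_syzygy_imp_not_surjective:
  assumes C: "low_syzygy d (C :: 'k poly)" and "d \<ge> 1"
  shows "\<not> surjective_mod (pure_power_ideal d) (linear_form c) (2 * d - 2 - d div 2)"
proof
  assume surj: "surjective_mod (pure_power_ideal d) (linear_form c) (2 * d - 2 - d div 2)"
  define h e where "h = d div 2" and "e = d - 1 - d div 2"
  have pos: "h > 0"
    using C unfolding h_def by (rule low_syzygy_pos)
  have deg_eq: "Suc (2 * d - 2 - d div 2) = d + e"
    using assms(2) div_less_dividend[of 2 d] unfolding e_def by linarith
  have he: "d = Suc (e + h)"
    using assms(2) by (simp add: e_def h_def)
  have C_high: "Polynomial.coeff C i = 0" if "h \<le> i" for i
    using C that by (simp add: low_syzygy_def h_def)
  have C_mid: "Polynomial.coeff (C * [:1, 1:] ^ d) i = 0" if "h \<le> i" "i < d" for i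
    using C that by (simp add: low_syzygy_def h_def)
  have C_low: "Polynomial.coeff C (d - 1 - i) = 0" if i: "i < d" for i
  proof -
    let ?t = "Poly_Mapping.single 1 i + Poly_Mapping.single 2 (d + e - i) :: 3 \<Rightarrow>\<^sub>0 nat"
    define g where "g = (Poly_Mapping.single ?t 1 :: (3, 'k) mpoly)"
    have g: "g \<in> homogeneous_part (d + e)"
      unfolding g_def using i by (intro homogeneous_single) (simp add: mon_degree_add)
    then obtain f where f: "f \<in> homogeneous_part (2 * d - 2 - d div 2)"
        "g - linear_form c * f \<in> pure_power_ideal d"
      using surj unfolding surjective_mod_def deg_eq by blast
    have "linear_form c * f \<in> homogeneous_part (d + e)"
      using homogeneous_mult[OF linear_form_homogeneous f(1)] deg_eq by simp
    then have "g - linear_form c * f \<in> homogeneous_part (d + e)"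
      by (intro homogeneous_minus g)
    then obtain \<alpha> where \<alpha>0: "g - linear_form c * f = (\<Sum>i\<in>UNIV. mvar i ^ d * \<alpha> i)"
        "\<And>i. \<alpha> i \<in> homogeneous_part (d + e - d)"
      using f(2) by (elim pure_power_idealE) blast
    note \<alpha> = \<alpha>0[unfolded diff_add_inverse]
    define A where "A = Polynomial.smult (1 / c 1 ^ d) (restrict_line c (\<alpha> 1))"
    define B where "B = Polynomial.smult (1 / c 2 ^ d) (restrict_line c (\<alpha> 2))"
    define D where "D = Polynomial.smult ((- 1 / c 3) ^ d) (restrict_line c (\<alpha> 3))"
    have deg: "Polynomial.degree B \<le> e" "Polynomial.degree D \<le> e"
      unfolding B_def D_def by (intro order_trans[OF degree_smult_le] degree_restrict_line \<alpha>(2))+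
    define \<kappa> where "\<kappa> = 1 / (c 1 ^ i * c 2 ^ (d + e - i))"
    have "Polynomial.monom \<kappa> i = restrict_line c (g - linear_form c * f)"
      by (simp add: restrict_line_minus restrict_line_mult restrict_line_linear_form g_def
          restrict_line_binary_monomial \<kappa>_def)
    also have "\<dots> = Polynomial.monom 1 d * A + B + D * [:1, 1:] ^ d"
      unfolding \<alpha>(1) restrict_line_combination A_def B_def D_def ..
    finally have "Polynomial.monom \<kappa> i * C =
        Polynomial.monom 1 d * (A * C) + B * C + (C * [:1, 1:] ^ d) * D"
      by (simp add: algebra_simps)
    then have "Polynomial.coeff (Polynomial.monom \<kappa> i * C) (d - 1) =
        Polynomial.coeff (B * C) (d - 1) + Polynomial.coeff ((C * [:1, 1:] ^ d) * D) (d - 1)"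
      using assms(2) by (simp add: coeff_monom_mult)
    also have "Polynomial.coeff (B * C) (d - 1) = 0"
    proof -
      have "Polynomial.degree C \<le> h - 1"
        using pos by (intro degree_le) (auto intro!: C_high)
      then have "Polynomial.degree (B * C) \<le> e + (h - 1)"
        using deg(1) by (intro order_trans[OF degree_mult_le] add_mono)
      then show ?thesis
        using pos he by (intro coeff_eq_0) simp
    qed
    also have "Polynomial.coeff ((C * [:1, 1:] ^ d) * D) (d - 1) = 0"
      unfolding coeff_mult[of "C * [:1, 1:] ^ d" D]
    proof (intro sum.neutral ballI)
      fix j assume j: "j \<in> {..d - 1}"
      show "Polynomial.coeff (C * [:1, 1:] ^ d) j * Polynomial.coeff D (d - 1 - j) = 0"
      proof (cases "h \<le> j")
        case True
        then show ?thesis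
          using C_mid[of j] j assms(2) by simp
      next
        case False
        then have "e < d - 1 - j"
          using he by simp
        then show ?thesis
          using deg(2) by (simp add: coeff_eq_0)
      qed
    qed
    finally have "\<kappa> * Polynomial.coeff C (d - 1 - i) = 0"
      using i by (simp only: coeff_monom_mult) (simp split: if_splits)
    moreover have "\<kappa> \<noteq> 0"
      using nz by (simp add: \<kappa>_def)
    ultimately show ?thesis
      by simp
  qed
  have "Polynomial.coeff C i = 0" if "i < h" for i
    using C_low[of "d - 1 - i"] that he by simp
  with C_high have "C = 0"
    by (intro poly_eqI) (metis coeff_0 not_le)
  with C show False
    by (simp add: low_syzygy_def)
qed

lemma no_low_syzygy_imp_maximal_rank:
  assumes "d \<ge> 1" "\<And>C. \<not> low_syzygy d (C :: 'k poly)"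
  shows "maximal_rank_mult (pure_power_ideal d) (linear_form c) m"
proof (cases "m + 2 \<le> d + d div 2")
  case True
  then show ?thesis
    unfolding maximal_rank_mult_iff[OF ideal_pure_power_ideal linear_form_homogeneous]
    using low_degree_injective[OF assms(2)] by blast
next
  case False
  moreover have "d \<le> 2 * (d div 2) + 1"
    by simp
  ultimately have "2 * d - 2 - d div 2 \<le> m"
    by linarith
  then have "surjective_mod (pure_power_ideal d) (linear_form c) m"
    using surjective_mod_mono[OF high_degree_surjective[OF assms(2,1)]] by blast
  then show ?thesis
    unfolding maximal_rank_mult_iff[OF ideal_pure_power_ideal linear_form_homogeneous] by blast
qed

text \<open>
  Surjectivity propagates upwards, so its failure propagates downwards.
\<close>

lemma low_syzygy_imp_not_surjective_middle:
  assumes "low_syzygy d (C :: 'k poly)" "d \<ge> 1"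
  shows "\<not> surjective_mod (pure_power_ideal d) (linear_form c) (d + d div 2 - 2)"
proof
  assume "surjective_mod (pure_power_ideal d) (linear_form c) (d + d div 2 - 2)"
  moreover have "2 * (d div 2) \<le> d"
    by simp
  then have "d + d div 2 - 2 \<le> 2 * d - 2 - d div 2"
    by linarith
  ultimately have "surjective_mod (pure_power_ideal d) (linear_form c) (2 * d - 2 - d div 2)"
    by (rule surjective_mod_mono)
  with low_syzygy_imp_not_surjective[OF assms] show False ..
qed

lemma low_syzygy_imp_not_maximal_rank:
  assumes "low_syzygy d (C :: 'k poly)" "d \<ge> 1"
  shows "\<not> maximal_rank_mult (pure_power_ideal d) (linear_form c) (d + d div 2 - 2)"
  unfolding maximal_rank_mult_iff[OF ideal_pure_power_ideal linear_form_homogeneous]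
  using low_syzygy_imp_not_injective[OF assms(1)] low_syzygy_imp_not_surjective_middle[OF assms] by blast

end

section \<open>General linear forms\<close>

lemma infinite_alg_closed_field: "infinite (UNIV :: 'k::alg_closed_field set)"
proof
  assume fin: "finite (UNIV :: 'k set)"
  define q where "q = (\<Prod>a\<in>(UNIV :: 'k set). [:- a, 1:])"
  have "Polynomial.degree q = card (UNIV :: 'k set)"
    unfolding q_def by (subst degree_prod_eq_sum_degree) auto
  moreover have "card (UNIV :: 'k set) > 0"
    using fin by (simp add: card_gt_0_iff)
  ultimately have "Polynomial.degree (q + 1) > 0"
    by (subst degree_add_eq_left) auto
  then obtain x where "poly (q + 1) x = 0"
    using alg_closed_imp_poly_has_root by blast
  moreover have "poly q x = 0"
    unfolding q_def poly_prod using fin by (intro prod_zero) auto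
  ultimately show False
    by simp
qed

text \<open>
  One coordinate at a time: as a polynomial in that coordinate, \<open>f\<close> is nonzero and has finitely many roots.
\<close>

lemma mpoly_eval_nonzero_perturb:
  fixes f :: "('v::finite, 'k::alg_closed_field) mpoly"
  assumes "mpoly_eval f x \<noteq> 0"
  obtains y where "mpoly_eval f y \<noteq> 0" "\<And>i. y i \<noteq> 0"
proof -
  have "\<exists>y. mpoly_eval f y \<noteq> 0 \<and> (\<forall>i\<in>J. y i \<noteq> 0)" if "finite J" for J
    using that
  proof (induction J rule: finite_induct)
    case (insert i J)
    then obtain y where y: "mpoly_eval f y \<noteq> 0" "\<forall>j\<in>J. y j \<noteq> 0"
      by blast
    define q where "q = (\<Sum>t\<in>Poly_Mapping.keys f. Polynomial.monom
      (Poly_Mapping.lookup f t * (\<Prod>j\<in>UNIV - {i}. y j ^ Poly_Mapping.lookup t j)) (Poly_Mapping.lookup t i))"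
    have q: "poly q z = mpoly_eval f (y(i := z))" for z
    proof -
      have "(\<Prod>j\<in>UNIV. (y(i := z)) j ^ Poly_Mapping.lookup t j) =
          z ^ Poly_Mapping.lookup t i * (\<Prod>j\<in>UNIV - {i}. y j ^ Poly_Mapping.lookup t j)" for t
        by (subst prod.remove[of _ i]) auto
      then show ?thesis
        by (simp add: q_def mpoly_eval_def poly_sum poly_monom mult_ac)
    qed
    from q[of "y i"] y(1) have "q \<noteq> 0"
      by auto
    then have "finite (insert 0 {z. poly q z = 0})"
      by (simp add: poly_roots_finite)
    then obtain z where z: "z \<noteq> 0" "poly q z \<noteq> 0"
      using infinite_alg_closed_field ex_new_if_finite by (metis (mono_tags, lifting) insertCI mem_Collect_eq)
    have "mpoly_eval f (y(i := z)) \<noteq> 0"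
      using z(2) q[of z] by simp
    moreover have "\<forall>j\<in>insert i J. (y(i := z)) j \<noteq> 0"
      using y(2) z(1) by simp
    ultimately show ?case
      by blast
  qed (use assms in auto)
  from this[of UNIV] show ?thesis
    using that by auto
qed

lemma zariski_open_meets_torus:
  fixes U :: "('v::finite \<Rightarrow> 'k::alg_closed_field) set"
  assumes "zariski_open U" "U \<noteq> {}"
  obtains y where "y \<in> U" "\<And>i. y i \<noteq> 0"
proof -
  obtain S :: "('v, 'k) mpoly set" where S: "- U = {x. \<forall>f\<in>S. mpoly_eval f x = 0}"
    using assms(1) by (auto simp: zariski_open_def zariski_closed_def)
  obtain x where "x \<in> U"
    using assms(2) by blast
  with S obtain f where f: "f \<in> S" "mpoly_eval f x \<noteq> 0"
    by blast
  obtain y where "mpoly_eval f y \<noteq> 0" "\<And>i. y i \<noteq> 0"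
    using mpoly_eval_nonzero_perturb[OF f(2)] by blast
  with S f(1) show ?thesis
    using that by blast
qed

lemma zariski_open_torus: "zariski_open {x :: 'v::finite \<Rightarrow> 'k::field. \<forall>i. x i \<noteq> 0}"
proof -
  \<comment> \<open>The complement is the zero set of the product of all variables.\<close>
  define t :: "'v \<Rightarrow>\<^sub>0 nat" where "t = Abs_poly_mapping (\<lambda>_. 1)"
  have t: "Poly_Mapping.lookup t i = 1" for i
    by (simp add: t_def)
  have "mpoly_eval (Poly_Mapping.single t 1) x = (\<Prod>i\<in>UNIV. x i)" for x :: "'v \<Rightarrow> 'k"
    by (simp add: mpoly_eval_def t)
  then show ?thesis
    unfolding zariski_open_def zariski_closed_def
    by (intro exI[of _ "{Poly_Mapping.single t 1}"]) (auto simp: prod_zero_iff)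
qed

text \<open>
  Whether the maps have maximal rank is the same for all linear forms without zero coefficients, and those forms
  are a nonempty open set that meets every other one.
\<close>

lemma weak_lefschetz_iff_no_low_syzygy:
  assumes "d \<ge> 1"
  shows "weak_lefschetz (monomial_ci_ideal d :: (3, 'k::alg_closed_field) mpoly set) \<longleftrightarrow>
    \<not> (\<exists>C :: 'k poly. low_syzygy d C)"
proof
  assume "weak_lefschetz (monomial_ci_ideal d :: (3, 'k) mpoly set)"
  then obtain s U where s: "\<And>m. m > s \<Longrightarrow> (homogeneous_part m :: (3, 'k) mpoly set) \<subseteq> pure_power_ideal d"
    and U: "zariski_open U" "U \<noteq> {}"
    and max: "\<And>c m. c \<in> U \<Longrightarrow> m < s \<Longrightarrow>
      maximal_rank_mult (pure_power_ideal d :: (3, 'k) mpoly set) (linear_form c) m"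
    unfolding weak_lefschetz_def monomial_ci_ideal_eq quot_component_trivial_iff[OF ideal_pure_power_ideal]
    by blast
  obtain c where c: "c \<in> U" "\<And>i. c i \<noteq> 0"
    using zariski_open_meets_torus[OF U] by blast
  show "\<not> (\<exists>C :: 'k poly. low_syzygy d C)"
  proof
    assume "\<exists>C :: 'k poly. low_syzygy d C"
    then obtain C :: "'k poly" where C: "low_syzygy d C" ..
    define m where "m = d + d div 2 - 2"
    have "\<not> maximal_rank_mult (pure_power_ideal d) (linear_form c) m"
      unfolding m_def using c(2) C assms by (rule low_syzygy_imp_not_maximal_rank)
    \<comment> \<open>The bound \<open>s\<close> might be at most \<open>m\<close>; then the target in degree \<open>m + 1\<close> is zero, against the failure
      of surjectivity.\<close>
    with max[OF c(1)] have "s \<le> m"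
      by (metis not_le)
    with s[of "Suc m"] have "surjective_mod (pure_power_ideal d) (linear_form c) m"
      unfolding surjective_mod_def by (auto intro!: bexI[of _ 0])
    moreover have "\<not> surjective_mod (pure_power_ideal d) (linear_form c) m"
      unfolding m_def using c(2) C assms by (rule low_syzygy_imp_not_surjective_middle)
    ultimately show False
      by contradiction
  qed
next
  assume no: "\<not> (\<exists>C :: 'k poly. low_syzygy d C)"
  define U :: "(3 \<Rightarrow> 'k) set" where "U = {x. \<forall>i. x i \<noteq> 0}"
  have "f \<in> pure_power_ideal d" if "m > 3 * d" "f \<in> homogeneous_part m" for m and f :: "(3, 'k) mpoly"
    unfolding pure_power_ideal_def
  proof (intro CollectI ballI, rule ccontr)
    fix t assume t: "t \<in> Poly_Mapping.keys f" "\<not> (\<exists>i. d \<le> Poly_Mapping.lookup t i)"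
    then have "mon_degree t \<le> d + d + d"
      unfolding mon_degree_def sum_three by (intro add_mono) (simp_all add: not_le less_imp_le)
    with t(1) that show False
      by (auto simp: homogeneous_part_def)
  qed
  moreover have "zariski_open U"
    unfolding U_def by (rule zariski_open_torus)
  moreover have "(\<lambda>_. 1) \<in> U"
    by (simp add: U_def)
  moreover have "maximal_rank_mult (pure_power_ideal d) (linear_form c) m" if "c \<in> U" for c m
    using that assms no unfolding U_def by (intro no_low_syzygy_imp_maximal_rank) auto
  ultimately show "weak_lefschetz (monomial_ci_ideal d :: (3, 'k) mpoly set)"
    unfolding weak_lefschetz_def monomial_ci_ideal_eq quot_component_trivial_iff[OF ideal_pure_power_ideal]
    by (intro exI[of _ "3 * d"] conjI exI[of _ U]) auto
qed

section \<open>The numerical criterion\<close>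

lemma resonant_even:
  assumes "even d"
  shows "resonant d q \<longleftrightarrow> (\<exists>k :: nat. 3 * real d / (6 * real k + 2) > real q \<and> real q > 3 * real d / (6 * real k + 4))"
proof -
  obtain r where d: "d = 2 * r"
    using assms by (elim evenE)
  have "(3 * k + 1) * q < d + d div 2 \<and> d + Suc d div 2 < (3 * k + 2) * q \<longleftrightarrow>
      3 * real d / (6 * real k + 2) > real q \<and> real q > 3 * real d / (6 * real k + 4)" for k
  proof -
    have "3 * real d / (6 * real k + 2) > real q \<longleftrightarrow> real (3 * d) > real ((6 * k + 2) * q)"
      by (simp add: field_simps add_pos_nonneg)
    also have "\<dots> \<longleftrightarrow> (3 * k + 1) * q < d + d div 2"
      unfolding of_nat_less_iff by (simp add: d algebra_simps) linarith
    finally have 1: "3 * real d / (6 * real k + 2) > real q \<longleftrightarrow> (3 * k + 1) * q < d + d div 2" .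
    have "real q > 3 * real d / (6 * real k + 4) \<longleftrightarrow> real ((6 * k + 4) * q) > real (3 * d)"
      by (simp add: field_simps add_pos_nonneg)
    also have "\<dots> \<longleftrightarrow> d + Suc d div 2 < (3 * k + 2) * q"
      unfolding of_nat_less_iff by (simp add: d algebra_simps) linarith
    finally show ?thesis
      using 1 by blast
  qed
  then show ?thesis
    by (simp add: resonant_def)
qed

lemma resonant_odd:
  assumes "odd d"
  shows "resonant d q \<longleftrightarrow>
    (\<exists>k :: nat. (3 * real d - 1) / (6 * real k + 2) > real q \<and> real q > (3 * real d + 1) / (6 * real k + 4))"
proof -
  obtain r where d: "d = Suc (2 * r)"
    using assms by (auto elim: oddE)
  have "(3 * k + 1) * q < d + d div 2 \<and> d + Suc d div 2 < (3 * k + 2) * q \<longleftrightarrow>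
      (3 * real d - 1) / (6 * real k + 2) > real q \<and> real q > (3 * real d + 1) / (6 * real k + 4)" for k
  proof -
    have "(3 * real d - 1) / (6 * real k + 2) > real q \<longleftrightarrow> real (3 * d) > real ((6 * k + 2) * q + 1)"
      by (simp add: field_simps add_pos_nonneg)
    also have "\<dots> \<longleftrightarrow> (3 * k + 1) * q < d + d div 2"
      unfolding of_nat_less_iff by (simp add: d algebra_simps) linarith
    finally have 1: "(3 * real d - 1) / (6 * real k + 2) > real q \<longleftrightarrow> (3 * k + 1) * q < d + d div 2" .
    have "real q > (3 * real d + 1) / (6 * real k + 4) \<longleftrightarrow> real ((6 * k + 4) * q) > real (3 * d + 1)"
      by (simp add: field_simps add_pos_nonneg)
    also have "\<dots> \<longleftrightarrow> d + Suc d div 2 < (3 * k + 2) * q"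
      unfolding of_nat_less_iff by (simp add: d algebra_simps) linarith
    finally show ?thesis
      using 1 by blast
  qed
  then show ?thesis
    by (simp add: resonant_def)
qed

theorem theorem2p6:
  fixes p d :: nat
  assumes char: "CHAR('k::alg_closed_field) = p" and "p > 0" and "d \<ge> 1"
  shows "(even d \<longrightarrow>
           (\<not> weak_lefschetz (monomial_ci_ideal d :: (3, 'k) mpoly set) \<longleftrightarrow>
            (\<exists>k n :: nat. n \<ge> 1 \<and>
               3 * real d / (6 * real k + 2) > real p ^ n \<and>
               real p ^ n > 3 * real d / (6 * real k + 4)))) \<and>
         (odd d \<longrightarrow>
           (\<not> weak_lefschetz (monomial_ci_ideal d :: (3, 'k) mpoly set) \<longleftrightarrow>
            (\<exists>k n :: nat. n \<ge> 1 \<and>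
               (3 * real d - 1) / (6 * real k + 2) > real p ^ n \<and>
               real p ^ n > (3 * real d + 1) / (6 * real k + 4))))"
proof -
  have "prime CHAR('k)"
    using assms by (intro prime_CHAR_semidom) simp
  then have "(\<exists>C :: 'k poly. low_syzygy d C) \<longleftrightarrow> (\<exists>n\<ge>1. resonant d (p ^ n))"
    using low_syzygy_imp_resonant resonant_imp_low_syzygy unfolding char[symmetric] by blast
  then have "\<not> weak_lefschetz (monomial_ci_ideal d :: (3, 'k) mpoly set) \<longleftrightarrow>
      (\<exists>n\<ge>1. resonant d (p ^ n))"
    using weak_lefschetz_iff_no_low_syzygy[OF \<open>d \<ge> 1\<close>, where 'k = 'k] by blast
  moreover have "(\<exists>n\<ge>1. resonant d (p ^ n)) \<longleftrightarrow>
      (\<exists>k n :: nat. n \<ge> 1 \<and> 3 * real d / (6 * real k + 2) > real p ^ n \<and>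
         real p ^ n > 3 * real d / (6 * real k + 4))" if "even d"
    unfolding resonant_even[OF that] of_nat_power by blast
  moreover have "(\<exists>n\<ge>1. resonant d (p ^ n)) \<longleftrightarrow>
      (\<exists>k n :: nat. n \<ge> 1 \<and> (3 * real d - 1) / (6 * real k + 2) > real p ^ n \<and>
         real p ^ n > (3 * real d + 1) / (6 * real k + 4))" if "odd d"
    unfolding resonant_odd[OF that] of_nat_power by blast
  ultimately show ?thesis
    by simp
qed

end
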